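(* The families of morphisms $f: I_{\mathsf{ImpBiLat}}\to FG$ and $g: I_{\mathsf{CILat}}\to GF$ given by $f_{\mathbf B}(a)=\langle a\land\top,\neg a\land\top\rangle$ for $a\in B$ and $g_{\mathbf L}(a)=\langle a,1\rangle$ for $a\in L$ are natural isomorphisms, so that the categories $\mathsf{CILat}$ and $\mathsf{ImpBiLat}$ are naturally equivalent.
   Context: A bilattice is an algebra $\langle B,\land,\lor,\otimes,\oplus,\neg\rangle$ such that $\langle B,\land,\lor\rangle$ and $\langle B,\otimes,\oplus\rangle$ are lattices (not necessarily bounded) with orders $\leq_t$ and $\leq_k$, and $\neg$ is unary with: $a\leq_t b\Rightarrow\neg b\leq_t\neg a$; $a\leq_k b\Rightarrow\neg a\leq_k\neg b$; $\neg\neg a=a$. An implicative bilattice is an algebra $\langle B,\land,\lor,\otimes,\oplus,\supset,\neg\rangle$ whose $\supset$-free reduct is a bilattice and which satisfies: (IB1) $(x\supset x)\supset y\approx y$; (IB2) $x\supset(y\supset z)\approx(x\land y)\supset z\approx(x\otimes y)\supset z$; (IB3) $((x\supset y)\supset x)\supset x\approx x\supset x$; (IB4) $(x\lor y)\supset z\approx(x\supset z)\land(y\supset z)\approx(x\oplus y)\supset z$; (IB5) $x\land((x\supset y)\supset(x\otimes y))\approx x$; (IB6) $\neg(x\supset y)\supset z\approx(x\land\neg y)\supset z$. In an implicative bilattice the term $(x\supset x)\oplus\neg(x\supset x)$ is constant; its value is denoted $\top$ and is the $\leq_k$-maximum. $\mathsf{ImpBiLat}$ is the category of implicative bilattices with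 all homomorphisms. A classical implicative lattice is a relatively complemented distributive lattice with maximum $1$, regarded as an algebra $\langle L,\sqcap,\sqcup,\backslash,1\rangle$ where $a\backslash b$ is the relative complement of $a$ in $[a\sqcap b,1]$. $\mathsf{CILat}$ is the category of classical implicative lattices with all homomorphisms (preserving $\sqcap,\sqcup,\backslash,1$). $I_{\mathsf C}$ is the identity functor of $\mathsf C$. The functor $F:\mathsf{CILat}\to\mathsf{ImpBiLat}$ sends $\mathbf L$ to the implicative bilattice $\langle\mathbf L\odot\mathbf L,\supset\rangle$ with universe $L\times L$ and operations $\langle a_1,a_2\rangle\land\langle b_1,b_2\rangle=\langle a_1\sqcap b_1,a_2\sqcup b_2\rangle$, $\langle a_1,a_2\rangle\lor\langle b_1,b_2\rangle=\langle a_1\sqcup b_1,a_2\sqcap b_2\rangle$, $\langle a_1,a_2\rangle\otimes\langle b_1,b_2\rangle=\langle a_1\sqcap b_1,a_2\sqcap b_2\rangle$, $\langle a_1,a_2\rangle\oplus\langle b_1,b_2\rangle=\langle a_1\sqcup b_1,a_2\sqcup b_2\rangle$, $\neg\langle a_1,a_2\rangle=\langle a_2,a_1\rangle$, $\langle a_1,a_2\rangle\supset\langle b_1,b_2\rangle=\langle a_1\backslash b_1,a_1\sqcap b_2\rangle$; and $F(h)(\langle a,b\rangle)=\langle h(a),h(b)\rangle$. The functor $G:\mathsf{ImpBiLat}\to\mathsf{CILat}$ sends $\mathbf B$ to the classical implicative lattice $\mathbf B^-=\langle\{a\in B: a\leq_t\top\},\land,\lor,\backslash,\top\rangle$, where $a\backslash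 b=(a\supset(a\land b))\land\top$; and $G(k)(a)=k(a)$. *)

theory Defs
  imports "HOL-Algebra.Congruence"
begin

section \<open>Algebras\<close>

locale lattice_on =
  fixes A :: "'a set"
    and m :: "'a \<Rightarrow> 'a \<Rightarrow> 'a" (infixl "\<^bold>\<sqinter>" 70)
    and j :: "'a \<Rightarrow> 'a \<Rightarrow> 'a" (infixl "\<^bold>\<squnion>" 65)
  assumes meet_closed: "\<lbrakk>x \<in> A; y \<in> A\<rbrakk> \<Longrightarrow> x \<^bold>\<sqinter> y \<in> A"
    and join_closed: "\<lbrakk>x \<in> A; y \<in> A\<rbrakk> \<Longrightarrow> x \<^bold>\<squnion> y \<in> A"
    and meet_commute: "\<lbrakk>x \<in> A; y \<in> A\<rbrakk> \<Longrightarrow> x \<^bold>\<sqinter> y = y \<^bold>\<sqinter> x"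
    and join_commute: "\<lbrakk>x \<in> A; y \<in> A\<rbrakk> \<Longrightarrow> x \<^bold>\<squnion> y = y \<^bold>\<squnion> x"
    and meet_assoc: "\<lbrakk>x \<in> A; y \<in> A; z \<in> A\<rbrakk> \<Longrightarrow> (x \<^bold>\<sqinter> y) \<^bold>\<sqinter> z = x \<^bold>\<sqinter> (y \<^bold>\<sqinter> z)"
    and join_assoc: "\<lbrakk>x \<in> A; y \<in> A; z \<in> A\<rbrakk> \<Longrightarrow> (x \<^bold>\<squnion> y) \<^bold>\<squnion> z = x \<^bold>\<squnion> (y \<^bold>\<squnion> z)"
    and meet_join_absorb: "\<lbrakk>x \<in> A; y \<in> A\<rbrakk> \<Longrightarrow> x \<^bold>\<sqinter> (x \<^bold>\<squnion> y) = x"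
    and join_meet_absorb: "\<lbrakk>x \<in> A; y \<in> A\<rbrakk> \<Longrightarrow> x \<^bold>\<squnion> (x \<^bold>\<sqinter> y) = x"


record 'a cilat = "'a partial_object" +
  meet :: "'a \<Rightarrow> 'a \<Rightarrow> 'a" (infixl "\<sqinter>\<index>" 70)
  join :: "'a \<Rightarrow> 'a \<Rightarrow> 'a" (infixl "\<squnion>\<index>" 65)
  relc :: "'a \<Rightarrow> 'a \<Rightarrow> 'a" (infixl "\<setminus>\<index>" 70)
  top_el :: 'a ("\<one>\<index>")

definition cle :: "('a, 'b) cilat_scheme \<Rightarrow> 'a \<Rightarrow> 'a \<Rightarrow> bool" (infix "\<sqsubseteq>\<index>" 50)
  where "a \<sqsubseteq>\<^bsub>L\<^esub> b \<longleftrightarrow> a \<sqinter>\<^bsub>L\<^esub> b = a"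

definition is_relative_complement ::
  "('a, 'b) cilat_scheme \<Rightarrow> 'a \<Rightarrow> 'a \<Rightarrow> 'a \<Rightarrow> 'a \<Rightarrow> bool"
  \<comment> \<open>\<open>y\<close> is a complement of \<open>x\<close> in the interval \<open>[a, b]\<close> of \<open>L\<close>\<close>
  where "is_relative_complement L a b x y \<longleftrightarrow>
    y \<in> carrier L \<and> a \<sqsubseteq>\<^bsub>L\<^esub> y \<and> y \<sqsubseteq>\<^bsub>L\<^esub> b \<and> x \<sqinter>\<^bsub>L\<^esub> y = a \<and> x \<squnion>\<^bsub>L\<^esub> y = b"

locale classical_implicative_lattice =
  lattice_on "carrier L" "meet L" "join L" for L (structure) +
  assumes distrib: "\<lbrakk>x \<in> carrier L; y \<in> carrier L; z \<in> carrier L\<rbrakk>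
      \<Longrightarrow> x \<sqinter> (y \<squnion> z) = (x \<sqinter> y) \<squnion> (x \<sqinter> z)"
    and relatively_complemented:
      "\<lbrakk>a \<in> carrier L; b \<in> carrier L; x \<in> carrier L; a \<sqsubseteq> x; x \<sqsubseteq> b\<rbrakk>
      \<Longrightarrow> \<exists>y. is_relative_complement L a b x y"
    and one_closed: "\<one> \<in> carrier L"
    and one_maximum: "x \<in> carrier L \<Longrightarrow> x \<sqsubseteq> \<one>"
    and relc: "\<lbrakk>a \<in> carrier L; b \<in> carrier L\<rbrakk>
      \<Longrightarrow> is_relative_complement L (a \<sqinter> b) \<one> a (a \<setminus> b)"


record 'a imp_bilat = "'a partial_object" +
  tmeet :: "'a \<Rightarrow> 'a \<Rightarrow> 'a" (infixl "\<^bold>\<and>\<index>" 70)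
  tjoin :: "'a \<Rightarrow> 'a \<Rightarrow> 'a" (infixl "\<^bold>\<or>\<index>" 65)
  kmeet :: "'a \<Rightarrow> 'a \<Rightarrow> 'a" (infixl "\<otimes>\<index>" 70)
  kjoin :: "'a \<Rightarrow> 'a \<Rightarrow> 'a" (infixl "\<oplus>\<index>" 65)
  impl :: "'a \<Rightarrow> 'a \<Rightarrow> 'a" (infixr "\<^bold>\<supset>\<index>" 60)
  neg :: "'a \<Rightarrow> 'a" ("\<^bold>\<not>\<index> _" [81] 80)

definition tle :: "('a, 'b) imp_bilat_scheme \<Rightarrow> 'a \<Rightarrow> 'a \<Rightarrow> bool" (infix "\<le>\<^sub>t\<index>" 50)
  where "a \<le>\<^sub>t\<^bsub>B\<^esub> b \<longleftrightarrow> a \<^bold>\<and>\<^bsub>B\<^esub> b = a"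

definition kle :: "('a, 'b) imp_bilat_scheme \<Rightarrow> 'a \<Rightarrow> 'a \<Rightarrow> bool" (infix "\<le>\<^sub>k\<index>" 50)
  where "a \<le>\<^sub>k\<^bsub>B\<^esub> b \<longleftrightarrow> a \<otimes>\<^bsub>B\<^esub> b = a"

locale bilattice =
  t: lattice_on "carrier B" "tmeet B" "tjoin B" +
  k: lattice_on "carrier B" "kmeet B" "kjoin B" for B (structure) +
  assumes nonempty: "carrier B \<noteq> {}"
    and neg_closed: "a \<in> carrier B \<Longrightarrow> \<^bold>\<not> a \<in> carrier B"
    and neg_t: "\<lbrakk>a \<in> carrier B; b \<in> carrier B; a \<le>\<^sub>t b\<rbrakk> \<Longrightarrow> \<^bold>\<not> b \<le>\<^sub>t \<^bold>\<not> a"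
    and neg_k: "\<lbrakk>a \<in> carrier B; b \<in> carrier B; a \<le>\<^sub>k b\<rbrakk> \<Longrightarrow> \<^bold>\<not> a \<le>\<^sub>k \<^bold>\<not> b"
    and neg_neg: "a \<in> carrier B \<Longrightarrow> \<^bold>\<not> (\<^bold>\<not> a) = a"

locale implicative_bilattice = bilattice +
  assumes impl_closed: "\<lbrakk>x \<in> carrier B; y \<in> carrier B\<rbrakk> \<Longrightarrow> x \<^bold>\<supset> y \<in> carrier B"
    and IB1: "\<lbrakk>x \<in> carrier B; y \<in> carrier B\<rbrakk> \<Longrightarrow> (x \<^bold>\<supset> x) \<^bold>\<supset> y = y"
    and IB2: "\<lbrakk>x \<in> carrier B; y \<in> carrier B; z \<in> carrier B\<rbrakk>
      \<Longrightarrow> x \<^bold>\<supset> (y \<^bold>\<supset> z) = (x \<^bold>\<and> y) \<^bold>\<supset> z \<and> (x \<^bold>\<and> y) \<^bold>\<supset> z = (x \<otimes> y) \<^bold>\<supset> z"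
    and IB3: "\<lbrakk>x \<in> carrier B; y \<in> carrier B\<rbrakk>
      \<Longrightarrow> ((x \<^bold>\<supset> y) \<^bold>\<supset> x) \<^bold>\<supset> x = x \<^bold>\<supset> x"
    and IB4: "\<lbrakk>x \<in> carrier B; y \<in> carrier B; z \<in> carrier B\<rbrakk>
      \<Longrightarrow> (x \<^bold>\<or> y) \<^bold>\<supset> z = (x \<^bold>\<supset> z) \<^bold>\<and> (y \<^bold>\<supset> z) \<and>
          (x \<^bold>\<supset> z) \<^bold>\<and> (y \<^bold>\<supset> z) = (x \<oplus> y) \<^bold>\<supset> z"
    and IB5: "\<lbrakk>x \<in> carrier B; y \<in> carrier B\<rbrakk>
      \<Longrightarrow> x \<^bold>\<and> ((x \<^bold>\<supset> y) \<^bold>\<supset> (x \<otimes> y)) = x"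
    and IB6: "\<lbrakk>x \<in> carrier B; y \<in> carrier B; z \<in> carrier B\<rbrakk>
      \<Longrightarrow> (\<^bold>\<not> (x \<^bold>\<supset> y)) \<^bold>\<supset> z = (x \<^bold>\<and> \<^bold>\<not> y) \<^bold>\<supset> z"

text \<open>In an implicative bilattice the term below has the same value for every \<open>x\<close>.\<close>

definition ktop :: "('a, 'b) imp_bilat_scheme \<Rightarrow> 'a" ("\<^bold>\<top>\<index>")
  where "\<^bold>\<top>\<^bsub>B\<^esub> =
    (THE c. \<exists>x\<in>carrier B. c = (x \<^bold>\<supset>\<^bsub>B\<^esub> x) \<oplus>\<^bsub>B\<^esub> (\<^bold>\<not>\<^bsub>B\<^esub> (x \<^bold>\<supset>\<^bsub>B\<^esub> x)))"


section \<open>Categories\<close>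

text \<open>
  Identities and composition are indexed by objects, so that an arrow need not
  determine its domain and codomain: \<open>Cmp C X Y Z g f\<close> is \<open>g\<close> after \<open>f\<close>
  for \<open>f : X \<rightarrow> Y\<close> and \<open>g : Y \<rightarrow> Z\<close>.
\<close>

record ('o, 'm) cat =
  Obj :: "'o set"
  Hom :: "'o \<Rightarrow> 'o \<Rightarrow> 'm set"
  Idn :: "'o \<Rightarrow> 'm"
  Cmp :: "'o \<Rightarrow> 'o \<Rightarrow> 'o \<Rightarrow> 'm \<Rightarrow> 'm \<Rightarrow> 'm"

definition is_category :: "('o, 'm) cat \<Rightarrow> bool" where
  "is_category C \<longleftrightarrow>
    (\<forall>X\<in>Obj C. Idn C X \<in> Hom C X X) \<and>
    (\<forall>X\<in>Obj C. \<forall>Y\<in>Obj C. \<forall>Z\<in>Obj C. \<forall>f\<in>Hom C X Y. \<forall>g\<in>Hom C Y Z.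
      Cmp C X Y Z g f \<in> Hom C X Z) \<and>
    (\<forall>X\<in>Obj C. \<forall>Y\<in>Obj C. \<forall>f\<in>Hom C X Y.
      Cmp C X X Y f (Idn C X) = f \<and> Cmp C X Y Y (Idn C Y) f = f) \<and>
    (\<forall>W\<in>Obj C. \<forall>X\<in>Obj C. \<forall>Y\<in>Obj C. \<forall>Z\<in>Obj C.
      \<forall>f\<in>Hom C W X. \<forall>g\<in>Hom C X Y. \<forall>h\<in>Hom C Y Z.
      Cmp C W X Z (Cmp C X Y Z h g) f = Cmp C W Y Z h (Cmp C W X Y g f))"

record ('o1, 'm1, 'o2, 'm2) fctr =
  obj_map :: "'o1 \<Rightarrow> 'o2"
  arr_map :: "'o1 \<Rightarrow> 'o1 \<Rightarrow> 'm1 \<Rightarrow> 'm2"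

definition is_functor ::
  "('o1, 'm1) cat \<Rightarrow> ('o2, 'm2) cat \<Rightarrow> ('o1, 'm1, 'o2, 'm2) fctr \<Rightarrow> bool" where
  "is_functor C D T \<longleftrightarrow>
    is_category C \<and> is_category D \<and>
    (\<forall>X\<in>Obj C. obj_map T X \<in> Obj D) \<and>
    (\<forall>X\<in>Obj C. \<forall>Y\<in>Obj C. \<forall>f\<in>Hom C X Y.
      arr_map T X Y f \<in> Hom D (obj_map T X) (obj_map T Y)) \<and>
    (\<forall>X\<in>Obj C. arr_map T X X (Idn C X) = Idn D (obj_map T X)) \<and>
    (\<forall>X\<in>Obj C. \<forall>Y\<in>Obj C. \<forall>Z\<in>Obj C. \<forall>f\<in>Hom C X Y. \<forall>g\<in>Hom C Y Z.
      arr_map T X Z (Cmp C X Y Z g f) =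
      Cmp D (obj_map T X) (obj_map T Y) (obj_map T Z) (arr_map T Y Z g) (arr_map T X Y f))"

definition id_functor :: "('o, 'm, 'o, 'm) fctr" where
  "id_functor = \<lparr>obj_map = (\<lambda>X. X), arr_map = (\<lambda>X Y f. f)\<rparr>"

definition comp_functor ::
  "('o2, 'm2, 'o3, 'm3) fctr \<Rightarrow> ('o1, 'm1, 'o2, 'm2) fctr \<Rightarrow> ('o1, 'm1, 'o3, 'm3) fctr"
  (infixl "\<circ>\<^sub>F" 55) where
  "S \<circ>\<^sub>F T = \<lparr>obj_map = (\<lambda>X. obj_map S (obj_map T X)),
    arr_map = (\<lambda>X Y f. arr_map S (obj_map T X) (obj_map T Y) (arr_map T X Y f))\<rparr>"

definition natural_transformation ::
  "('o1, 'm1) cat \<Rightarrow> ('o2, 'm2) cat \<Rightarrow>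
   ('o1, 'm1, 'o2, 'm2) fctr \<Rightarrow> ('o1, 'm1, 'o2, 'm2) fctr \<Rightarrow> ('o1 \<Rightarrow> 'm2) \<Rightarrow> bool" where
  "natural_transformation C D S T \<eta> \<longleftrightarrow>
    is_functor C D S \<and> is_functor C D T \<and>
    (\<forall>X\<in>Obj C. \<eta> X \<in> Hom D (obj_map S X) (obj_map T X)) \<and>
    (\<forall>X\<in>Obj C. \<forall>Y\<in>Obj C. \<forall>f\<in>Hom C X Y.
      Cmp D (obj_map S X) (obj_map S Y) (obj_map T Y) (\<eta> Y) (arr_map S X Y f) =
      Cmp D (obj_map S X) (obj_map T X) (obj_map T Y) (arr_map T X Y f) (\<eta> X))"

definition is_isomorphism :: "('o, 'm) cat \<Rightarrow> 'o \<Rightarrow> 'o \<Rightarrow> 'm \<Rightarrow> bool" where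
  "is_isomorphism C X Y f \<longleftrightarrow>
    f \<in> Hom C X Y \<and>
    (\<exists>g\<in>Hom C Y X. Cmp C X Y X g f = Idn C X \<and> Cmp C Y X Y f g = Idn C Y)"

definition natural_isomorphism ::
  "('o1, 'm1) cat \<Rightarrow> ('o2, 'm2) cat \<Rightarrow>
   ('o1, 'm1, 'o2, 'm2) fctr \<Rightarrow> ('o1, 'm1, 'o2, 'm2) fctr \<Rightarrow> ('o1 \<Rightarrow> 'm2) \<Rightarrow> bool" where
  "natural_isomorphism C D S T \<eta> \<longleftrightarrow>
    natural_transformation C D S T \<eta> \<and>
    (\<forall>X\<in>Obj C. is_isomorphism D (obj_map S X) (obj_map T X) (\<eta> X))"

definition naturally_equivalent :: "('o1, 'm1) cat \<Rightarrow> ('o2, 'm2) cat \<Rightarrow> bool" where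
  "naturally_equivalent C D \<longleftrightarrow>
    (\<exists>S T \<eta> \<theta>. is_functor C D S \<and> is_functor D C T \<and>
      natural_isomorphism D D id_functor (S \<circ>\<^sub>F T) \<eta> \<and>
      natural_isomorphism C C id_functor (T \<circ>\<^sub>F S) \<theta>)"


section \<open>The categories of classical implicative lattices and of implicative bilattices\<close>

text \<open>
  Arrows are maps that take the value \<^term>\<open>undefined\<close> outside the carrier of the
  domain, so that equality of arrows is equality of maps between the carriers.
\<close>

definition cilat_hom :: "'a cilat \<Rightarrow> 'b cilat \<Rightarrow> ('a \<Rightarrow> 'b) set" where
  "cilat_hom L M = {h \<in> carrier L \<rightarrow>\<^sub>E carrier M.
    (\<forall>a\<in>carrier L. \<forall>b\<in>carrier L.
      h (a \<sqinter>\<^bsub>L\<^esub> b) = h a \<sqinter>\<^bsub>M\<^esub> h b \<and>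
      h (a \<squnion>\<^bsub>L\<^esub> b) = h a \<squnion>\<^bsub>M\<^esub> h b \<and>
      h (a \<setminus>\<^bsub>L\<^esub> b) = h a \<setminus>\<^bsub>M\<^esub> h b) \<and>
    h \<one>\<^bsub>L\<^esub> = \<one>\<^bsub>M\<^esub>}"

definition imp_bilat_hom :: "'a imp_bilat \<Rightarrow> 'b imp_bilat \<Rightarrow> ('a \<Rightarrow> 'b) set" where
  "imp_bilat_hom A B = {h \<in> carrier A \<rightarrow>\<^sub>E carrier B.
    (\<forall>a\<in>carrier A. \<forall>b\<in>carrier A.
      h (a \<^bold>\<and>\<^bsub>A\<^esub> b) = h a \<^bold>\<and>\<^bsub>B\<^esub> h b \<and>
      h (a \<^bold>\<or>\<^bsub>A\<^esub> b) = h a \<^bold>\<or>\<^bsub>B\<^esub> h b \<and>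
      h (a \<otimes>\<^bsub>A\<^esub> b) = h a \<otimes>\<^bsub>B\<^esub> h b \<and>
      h (a \<oplus>\<^bsub>A\<^esub> b) = h a \<oplus>\<^bsub>B\<^esub> h b \<and>
      h (a \<^bold>\<supset>\<^bsub>A\<^esub> b) = h a \<^bold>\<supset>\<^bsub>B\<^esub> h b) \<and>
    (\<forall>a\<in>carrier A. h (\<^bold>\<not>\<^bsub>A\<^esub> a) = \<^bold>\<not>\<^bsub>B\<^esub> (h a))}"

definition CILat :: "('a cilat, 'a \<Rightarrow> 'a) cat" where
  "CILat = \<lparr>Obj = {L. classical_implicative_lattice L}, Hom = cilat_hom,
    Idn = (\<lambda>L. \<lambda>a\<in>carrier L. a), Cmp = (\<lambda>L M N g f. compose (carrier L) g f)\<rparr>"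

definition ImpBiLat :: "('a imp_bilat, 'a \<Rightarrow> 'a) cat" where
  "ImpBiLat = \<lparr>Obj = {B. implicative_bilattice B}, Hom = imp_bilat_hom,
    Idn = (\<lambda>B. \<lambda>a\<in>carrier B. a), Cmp = (\<lambda>A B C g f. compose (carrier A) g f)\<rparr>"


section \<open>The functors and the two families of morphisms\<close>

text \<open>
  Since the product construction leads from \<open>L\<close> to \<open>L \<times> L\<close>, both categories have to be
  formed over a type that is closed under ordered pairs in order that the composites of
  the two functors be endofunctors.  The type \<open>'a univ\<close> is freely generated from \<open>'a\<close> by
  ordered pairing \<open>\<langle>_, _\<rangle>\<close>.  It contains an isomorphic copy, via \<open>Atom\<close>, of each
  algebra whose carrier is a subset of \<open>'a\<close>.
\<close>

datatype 'a univ =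
  Atom 'a
| OPair (ufst: "'a univ") (usnd: "'a univ") ("\<langle>_,/ _\<rangle>")

definition product_bilat :: "'a univ cilat \<Rightarrow> 'a univ imp_bilat" where
  "product_bilat L = \<lparr>
    carrier = {\<langle>a, b\<rangle> | a b. a \<in> carrier L \<and> b \<in> carrier L},
    tmeet = (\<lambda>x y. \<langle>ufst x \<sqinter>\<^bsub>L\<^esub> ufst y, usnd x \<squnion>\<^bsub>L\<^esub> usnd y\<rangle>),
    tjoin = (\<lambda>x y. \<langle>ufst x \<squnion>\<^bsub>L\<^esub> ufst y, usnd x \<sqinter>\<^bsub>L\<^esub> usnd y\<rangle>),
    kmeet = (\<lambda>x y. \<langle>ufst x \<sqinter>\<^bsub>L\<^esub> ufst y, usnd x \<sqinter>\<^bsub>L\<^esub> usnd y\<rangle>),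
    kjoin = (\<lambda>x y. \<langle>ufst x \<squnion>\<^bsub>L\<^esub> ufst y, usnd x \<squnion>\<^bsub>L\<^esub> usnd y\<rangle>),
    impl = (\<lambda>x y. \<langle>ufst x \<setminus>\<^bsub>L\<^esub> ufst y, ufst x \<sqinter>\<^bsub>L\<^esub> usnd y\<rangle>),
    neg = (\<lambda>x. \<langle>usnd x, ufst x\<rangle>)\<rparr>"

definition functor_F :: "('a univ cilat, 'a univ \<Rightarrow> 'a univ, 'a univ imp_bilat, 'a univ \<Rightarrow> 'a univ) fctr"
  where "functor_F = \<lparr>
    obj_map = product_bilat,
    arr_map = (\<lambda>L M h. \<lambda>x\<in>carrier (product_bilat L). \<langle>h (ufst x), h (usnd x)\<rangle>)\<rparr>"

definition lower_cilat :: "'a imp_bilat \<Rightarrow> 'a cilat" where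
  "lower_cilat B = \<lparr>
    carrier = {a \<in> carrier B. a \<le>\<^sub>t\<^bsub>B\<^esub> \<^bold>\<top>\<^bsub>B\<^esub>},
    meet = tmeet B,
    join = tjoin B,
    relc = (\<lambda>a b. (a \<^bold>\<supset>\<^bsub>B\<^esub> (a \<^bold>\<and>\<^bsub>B\<^esub> b)) \<^bold>\<and>\<^bsub>B\<^esub> \<^bold>\<top>\<^bsub>B\<^esub>),
    top_el = \<^bold>\<top>\<^bsub>B\<^esub>\<rparr>"

definition functor_G :: "('a imp_bilat, 'a \<Rightarrow> 'a, 'a cilat, 'a \<Rightarrow> 'a) fctr" where
  "functor_G = \<lparr>
    obj_map = lower_cilat,
    arr_map = (\<lambda>A B k. \<lambda>a\<in>carrier (lower_cilat A). k a)\<rparr>"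

definition family_f :: "'a univ imp_bilat \<Rightarrow> 'a univ \<Rightarrow> 'a univ" where
  "family_f B = (\<lambda>a\<in>carrier B.
    \<langle>a \<^bold>\<and>\<^bsub>B\<^esub> \<^bold>\<top>\<^bsub>B\<^esub>, (\<^bold>\<not>\<^bsub>B\<^esub> a) \<^bold>\<and>\<^bsub>B\<^esub> \<^bold>\<top>\<^bsub>B\<^esub>\<rangle>)"

definition family_g :: "'a univ cilat \<Rightarrow> 'a univ \<Rightarrow> 'a univ" where
  "family_g L = (\<lambda>a\<in>carrier L. \<langle>a, \<one>\<^bsub>L\<^esub>\<rangle>)"

end

theory Submission
  imports Defs
begin

text \<open>
  Call \<open>d\<close> designated if \<open>d \<^bold>\<supset> d = d\<close>, and let \<open>x \<^bold>\<lesssim> y\<close> mean that \<open>x \<^bold>\<supset> y\<close> is designated.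
  This preorder makes an implicative bilattice, up to equivalence, a classical implicative lattice
  in which both meets agree and both joins agree, and (IB5) shows that \<open>x \<le>\<^sub>t y\<close> iff
  \<open>x \<^bold>\<lesssim> y\<close> and \<open>\<^bold>\<not> y \<^bold>\<lesssim> \<^bold>\<not> x\<close>.
  So an element is determined by the classes of itself and of its negation.  Each class has exactly
  one representative below \<open>\<^bold>\<top>\<close>, namely \<open>x \<^bold>\<and> \<^bold>\<top>\<close>, and the pair \<open>\<langle>a, b\<rangle>\<close> of such
  representatives is attained at \<open>a \<otimes> \<^bold>\<not> b\<close>.
\<close>

section \<open>Lattices on a carrier\<close>

context lattice_on
begin

text \<open>The order lives in \<open>lattice_on\<close> so that one stock of order lemmas serves
  \<open>L\<close> and both orders of a bilattice.\<close>

definition le (infix "\<^bold>\<preceq>" 50) where "x \<^bold>\<preceq> y \<longleftrightarrow> x \<^bold>\<sqinter> y = x"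

lemma meet_idem [simp]: "x \<in> A \<Longrightarrow> x \<^bold>\<sqinter> x = x"
  by (metis join_meet_absorb meet_closed meet_join_absorb)

lemma le_refl [simp]: "x \<in> A \<Longrightarrow> x \<^bold>\<preceq> x"
  by (simp add: le_def)

lemma le_antisym: "\<lbrakk>x \<^bold>\<preceq> y; y \<^bold>\<preceq> x; x \<in> A; y \<in> A\<rbrakk> \<Longrightarrow> x = y"
  by (metis le_def meet_commute)

lemma le_trans: "\<lbrakk>x \<^bold>\<preceq> y; y \<^bold>\<preceq> z; x \<in> A; y \<in> A; z \<in> A\<rbrakk> \<Longrightarrow> x \<^bold>\<preceq> z"
  by (metis le_def meet_assoc)

lemma le_iff_join: "\<lbrakk>x \<in> A; y \<in> A\<rbrakk> \<Longrightarrow> x \<^bold>\<preceq> y \<longleftrightarrow> x \<^bold>\<squnion> y = y"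
  by (metis le_def join_commute join_meet_absorb meet_commute meet_join_absorb)

lemma meet_le1 [simp]: "\<lbrakk>x \<in> A; y \<in> A\<rbrakk> \<Longrightarrow> x \<^bold>\<sqinter> y \<^bold>\<preceq> x"
  by (metis le_def meet_assoc meet_commute meet_idem)

lemma meet_le2 [simp]: "\<lbrakk>x \<in> A; y \<in> A\<rbrakk> \<Longrightarrow> x \<^bold>\<sqinter> y \<^bold>\<preceq> y"
  by (metis meet_commute meet_le1)

lemma le_join1 [simp]: "\<lbrakk>x \<in> A; y \<in> A\<rbrakk> \<Longrightarrow> x \<^bold>\<preceq> x \<^bold>\<squnion> y"
  by (simp add: le_def meet_join_absorb)

lemma le_join2 [simp]: "\<lbrakk>x \<in> A; y \<in> A\<rbrakk> \<Longrightarrow> y \<^bold>\<preceq> x \<^bold>\<squnion> y"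
  by (metis join_commute le_join1)

lemma le_meet_iff [simp]:
  "\<lbrakk>x \<in> A; y \<in> A; z \<in> A\<rbrakk> \<Longrightarrow> z \<^bold>\<preceq> x \<^bold>\<sqinter> y \<longleftrightarrow> z \<^bold>\<preceq> x \<and> z \<^bold>\<preceq> y"
  by (metis le_def le_trans meet_assoc meet_closed meet_le1 meet_le2)

lemma join_le_iff [simp]:
  "\<lbrakk>x \<in> A; y \<in> A; z \<in> A\<rbrakk> \<Longrightarrow> x \<^bold>\<squnion> y \<^bold>\<preceq> z \<longleftrightarrow> x \<^bold>\<preceq> z \<and> y \<^bold>\<preceq> z"
  by (metis join_assoc join_closed le_iff_join le_join1 le_join2 le_trans)

lemma eq_meetI:
  "\<lbrakk>z \<^bold>\<preceq> x; z \<^bold>\<preceq> y; \<And>w. \<lbrakk>w \<in> A; w \<^bold>\<preceq> x; w \<^bold>\<preceq> y\<rbrakk> \<Longrightarrow> w \<^bold>\<preceq> z;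
    x \<in> A; y \<in> A; z \<in> A\<rbrakk> \<Longrightarrow> z = x \<^bold>\<sqinter> y"
  by (rule le_antisym) (simp_all add: meet_closed)

lemma eq_joinI:
  "\<lbrakk>x \<^bold>\<preceq> z; y \<^bold>\<preceq> z; \<And>w. \<lbrakk>w \<in> A; x \<^bold>\<preceq> w; y \<^bold>\<preceq> w\<rbrakk> \<Longrightarrow> z \<^bold>\<preceq> w;
    x \<in> A; y \<in> A; z \<in> A\<rbrakk> \<Longrightarrow> z = x \<^bold>\<squnion> y"
  by (rule le_antisym) (simp_all add: join_closed)

end


section \<open>From classical implicative lattices to implicative bilattices\<close>

context classical_implicative_lattice
begin

lemmas closed = meet_closed join_closed one_closed

lemma cle_iff: "x \<sqsubseteq> y \<longleftrightarrow> le x y"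
  by (simp add: cle_def le_def)

lemma le_one [simp]: "x \<in> carrier L \<Longrightarrow> le x \<one>"
  using one_maximum by (simp add: cle_iff)

lemma one_meet [simp]: "x \<in> carrier L \<Longrightarrow> \<one> \<sqinter> x = x"
  by (metis le_def le_one meet_commute one_closed)

lemma meet_one [simp]: "x \<in> carrier L \<Longrightarrow> x \<sqinter> \<one> = x"
  using le_one le_def by blast

lemma join_one [simp]: "x \<in> carrier L \<Longrightarrow> x \<squnion> \<one> = \<one>"
  using le_one le_iff_join one_closed by blast

lemma relc_closed: "\<lbrakk>a \<in> carrier L; b \<in> carrier L\<rbrakk> \<Longrightarrow> a \<setminus> b \<in> carrier L"
  and meet_relc: "\<lbrakk>a \<in> carrier L; b \<in> carrier L\<rbrakk> \<Longrightarrow> a \<sqinter> (a \<setminus> b) = a \<sqinter> b"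
  and join_relc: "\<lbrakk>a \<in> carrier L; b \<in> carrier L\<rbrakk> \<Longrightarrow> a \<squnion> (a \<setminus> b) = \<one>"
  and meet_le_relc: "\<lbrakk>a \<in> carrier L; b \<in> carrier L\<rbrakk> \<Longrightarrow> le (a \<sqinter> b) (a \<setminus> b)"
  using relc by (auto simp: is_relative_complement_def cle_iff)

text \<open>The relative complement is the residuum of the meet. From left to right this uses
  \<open>a \<sqinter> (a \<setminus> b) = a \<sqinter> b\<close>; for the converse,
  \<open>a \<squnion> (a \<setminus> b) = \<one>\<close> and distributivity split \<open>c\<close>
  into two parts below \<open>a \<setminus> b\<close>.\<close>

lemma le_relc_iff:
  assumes "a \<in> carrier L" "b \<in> carrier L" "c \<in> carrier L"
  shows "le c (a \<setminus> b) \<longleftrightarrow> le (c \<sqinter> a) b"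
proof
  assume "le c (a \<setminus> b)"
  then have "le (c \<sqinter> a) (a \<sqinter> (a \<setminus> b))"
    using assms by (simp add: relc_closed closed) (meson closed le_trans meet_le1 relc_closed)
  then show "le (c \<sqinter> a) b"
    using assms by (simp add: meet_relc closed)
next
  assume *: "le (c \<sqinter> a) b"
  have "c = c \<sqinter> (a \<squnion> (a \<setminus> b))"
    using assms le_one by (simp add: join_relc le_def)
  also have "\<dots> = (c \<sqinter> a) \<squnion> (c \<sqinter> (a \<setminus> b))"
    using assms by (simp add: distrib relc_closed)
  finally have c: "c = (c \<sqinter> a) \<squnion> (c \<sqinter> (a \<setminus> b))" .
  have "le (c \<sqinter> a) (a \<sqinter> b)"
    using * assms by (simp add: closed)
  then have "le (c \<sqinter> a) (a \<setminus> b)"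
    using assms meet_le_relc by (meson closed le_trans relc_closed)
  then have "le ((c \<sqinter> a) \<squnion> (c \<sqinter> (a \<setminus> b))) (a \<setminus> b)"
    using assms by (simp add: closed relc_closed)
  then show "le c (a \<setminus> b)"
    using c by simp
qed

text \<open>An element is determined by its lower bounds, so identities for
  \<open>\<setminus>\<close> can be checked through the residuation law alone.\<close>

lemma eq_relcI:
  assumes "\<And>c. c \<in> carrier L \<Longrightarrow> le c d \<longleftrightarrow> le (c \<sqinter> a) b"
    and "a \<in> carrier L" "b \<in> carrier L" "d \<in> carrier L"
  shows "d = a \<setminus> b"
proof (rule le_antisym)
  show "le d (a \<setminus> b)"
    using assms(1) [of d] assms by (simp add: le_relc_iff)
  show "le (a \<setminus> b) d"
    using assms(1) [of "a \<setminus> b"] assms le_relc_iff [of a b "a \<setminus> b"] by (simp add: relc_closed)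
qed (simp_all add: assms relc_closed)

lemma relc_self: "a \<in> carrier L \<Longrightarrow> a \<setminus> a = \<one>"
  by (rule eq_relcI [symmetric]) (simp_all add: closed)

lemma one_relc: "a \<in> carrier L \<Longrightarrow> \<one> \<setminus> a = a"
  using le_one by (intro eq_relcI [symmetric]) (simp_all add: closed le_def)

lemma relc_relc:
  "\<lbrakk>a \<in> carrier L; b \<in> carrier L; c \<in> carrier L\<rbrakk> \<Longrightarrow> a \<setminus> (b \<setminus> c) = (a \<sqinter> b) \<setminus> c"
  by (rule eq_relcI) (simp_all add: closed relc_closed le_relc_iff meet_assoc)

lemma join_relc_left:
  assumes "a \<in> carrier L" "b \<in> carrier L" "c \<in> carrier L"
  shows "(a \<squnion> b) \<setminus> c = (a \<setminus> c) \<sqinter> (b \<setminus> c)"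
  using assms
  by (intro eq_relcI [symmetric]) (simp_all add: closed relc_closed le_relc_iff distrib)

lemma relc_meet_self:
  "\<lbrakk>a \<in> carrier L; b \<in> carrier L\<rbrakk> \<Longrightarrow> a \<setminus> (a \<sqinter> b) = a \<setminus> b"
  by (rule eq_relcI) (simp_all add: closed relc_closed le_relc_iff)

text \<open>The left side splits along \<open>a \<squnion> (a \<setminus> b) = \<one>\<close>; its
  part inside \<open>a \<setminus> b\<close> lies below \<open>a\<close> by residuation.\<close>

lemma peirce:
  assumes "a \<in> carrier L" "b \<in> carrier L"
  shows "(a \<setminus> b) \<setminus> a = a"
proof -
  define e where "e = (a \<setminus> b) \<setminus> a"
  have e: "e \<in> carrier L" "le (e \<sqinter> (a \<setminus> b)) a"
    using assms le_relc_iff [of "a \<setminus> b" a e] by (simp_all add: e_def relc_closed)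
  have "e = e \<sqinter> (a \<squnion> (a \<setminus> b))"
    using assms e le_one by (simp add: join_relc le_def)
  also have "\<dots> = (e \<sqinter> a) \<squnion> (e \<sqinter> (a \<setminus> b))"
    using assms e by (simp add: distrib relc_closed)
  also have "le \<dots> a"
    using assms e by (simp add: closed relc_closed)
  finally have "le e a" .
  moreover have "le a e"
    using assms by (simp add: e_def le_relc_iff relc_closed)
  ultimately show ?thesis
    using assms e le_antisym unfolding e_def by blast
qed

end

section \<open>The product bilattice on pairs\<close>

lemma product_bilat_simps [simp]:
  "\<langle>a, b\<rangle> \<in> carrier (product_bilat L) \<longleftrightarrow> a \<in> carrier L \<and> b \<in> carrier L"
  "\<langle>a, b\<rangle> \<^bold>\<and>\<^bsub>product_bilat L\<^esub> \<langle>c, d\<rangle> = \<langle>a \<sqinter>\<^bsub>L\<^esub> c, b \<squnion>\<^bsub>L\<^esub> d\<rangle>"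
  "\<langle>a, b\<rangle> \<^bold>\<or>\<^bsub>product_bilat L\<^esub> \<langle>c, d\<rangle> = \<langle>a \<squnion>\<^bsub>L\<^esub> c, b \<sqinter>\<^bsub>L\<^esub> d\<rangle>"
  "\<langle>a, b\<rangle> \<otimes>\<^bsub>product_bilat L\<^esub> \<langle>c, d\<rangle> = \<langle>a \<sqinter>\<^bsub>L\<^esub> c, b \<sqinter>\<^bsub>L\<^esub> d\<rangle>"
  "\<langle>a, b\<rangle> \<oplus>\<^bsub>product_bilat L\<^esub> \<langle>c, d\<rangle> = \<langle>a \<squnion>\<^bsub>L\<^esub> c, b \<squnion>\<^bsub>L\<^esub> d\<rangle>"
  "\<langle>a, b\<rangle> \<^bold>\<supset>\<^bsub>product_bilat L\<^esub> \<langle>c, d\<rangle> = \<langle>a \<setminus>\<^bsub>L\<^esub> c, a \<sqinter>\<^bsub>L\<^esub> d\<rangle>"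
  "\<^bold>\<not>\<^bsub>product_bilat L\<^esub> \<langle>a, b\<rangle> = \<langle>b, a\<rangle>"
  by (simp_all add: product_bilat_def)

lemma product_bilatE [elim!]:
  assumes "x \<in> carrier (product_bilat L)"
  obtains a b where "x = \<langle>a, b\<rangle>" "a \<in> carrier L" "b \<in> carrier L"
  using assms by (auto simp: product_bilat_def)

lemma lattice_on_product:
  assumes "classical_implicative_lattice K"
  shows "lattice_on (carrier (product_bilat K)) (tmeet (product_bilat K)) (tjoin (product_bilat K))"
    and "lattice_on (carrier (product_bilat K)) (kmeet (product_bilat K)) (kjoin (product_bilat K))"
proof -
  interpret K: classical_implicative_lattice K by fact
  note ac = K.meet_closed K.join_closed K.meet_commute K.join_commute K.meet_assoc K.join_assoc
      K.meet_join_absorb K.join_meet_absorb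
  show "lattice_on (carrier (product_bilat K)) (tmeet (product_bilat K)) (tjoin (product_bilat K))"
    and "lattice_on (carrier (product_bilat K)) (kmeet (product_bilat K)) (kjoin (product_bilat K))"
    by (unfold_locales; auto intro: ac)+
qed

text \<open>Read componentwise, the axioms become laws of the residuum: (IB2) rests on
  \<open>relc_relc\<close>, (IB3) on \<open>peirce\<close>, (IB4) on \<open>join_relc_left\<close>
  and distributivity.\<close>

lemma implicative_bilattice_product:
  assumes "classical_implicative_lattice L"
  shows "implicative_bilattice (product_bilat L)"
proof -
  interpret L: classical_implicative_lattice L by fact
  interpret t: lattice_on "carrier (product_bilat L)" "tmeet (product_bilat L)" "tjoin (product_bilat L)"
    by (rule lattice_on_product) fact
  interpret k: lattice_on "carrier (product_bilat L)" "kmeet (product_bilat L)" "kjoin (product_bilat L)"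
    by (rule lattice_on_product) fact
  note closed = L.closed L.relc_closed
  show ?thesis
  proof unfold_locales
    show "carrier (product_bilat L) \<noteq> {}"
      using L.one_closed product_bilat_simps(1) by blast
  next
    fix x y assume "x \<in> carrier (product_bilat L)" "y \<in> carrier (product_bilat L)"
      "x \<le>\<^sub>t\<^bsub>product_bilat L\<^esub> y"
    then show "\<^bold>\<not>\<^bsub>product_bilat L\<^esub> y \<le>\<^sub>t\<^bsub>product_bilat L\<^esub> \<^bold>\<not>\<^bsub>product_bilat L\<^esub> x"
      \<comment> \<open>The truth meet takes joins in the second component, so after the swap each
        order relation has to change between its meet form and its join form.\<close>
      by (auto simp: tle_def) (metis L.le_def L.le_iff_join L.join_commute L.meet_commute)+
  next
    fix x y assume "x \<in> carrier (product_bilat L)" "y \<in> carrier (product_bilat L)"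
    then show "((x \<^bold>\<supset>\<^bsub>product_bilat L\<^esub> y) \<^bold>\<supset>\<^bsub>product_bilat L\<^esub> x) \<^bold>\<supset>\<^bsub>product_bilat L\<^esub> x
      = x \<^bold>\<supset>\<^bsub>product_bilat L\<^esub> x"
      by (auto simp: L.peirce)
  next
    fix x y z assume "x \<in> carrier (product_bilat L)" "y \<in> carrier (product_bilat L)"
      "z \<in> carrier (product_bilat L)"
    then show "(x \<^bold>\<or>\<^bsub>product_bilat L\<^esub> y) \<^bold>\<supset>\<^bsub>product_bilat L\<^esub> z =
        (x \<^bold>\<supset>\<^bsub>product_bilat L\<^esub> z) \<^bold>\<and>\<^bsub>product_bilat L\<^esub> (y \<^bold>\<supset>\<^bsub>product_bilat L\<^esub> z) \<and>
      (x \<^bold>\<supset>\<^bsub>product_bilat L\<^esub> z) \<^bold>\<and>\<^bsub>product_bilat L\<^esub> (y \<^bold>\<supset>\<^bsub>product_bilat L\<^esub> z) =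
        (x \<oplus>\<^bsub>product_bilat L\<^esub> y) \<^bold>\<supset>\<^bsub>product_bilat L\<^esub> z"
      \<comment> \<open>What remains is the second component, where distributivity is needed with
        the join on the left of the meet.\<close>
      by (auto simp: L.join_relc_left) (metis L.distrib L.join_closed L.meet_commute)+
  next
    fix x y assume "x \<in> carrier (product_bilat L)" "y \<in> carrier (product_bilat L)"
    then obtain a b c d where xy: "x = \<langle>a, b\<rangle>" "y = \<langle>c, d\<rangle>"
      and [simp]: "a \<in> carrier L" "b \<in> carrier L" "c \<in> carrier L" "d \<in> carrier L"
      by auto
    \<comment> \<open>These two inequalities are the components of (IB5); the first is residuation
      together with \<open>L.meet_relc\<close>.\<close>
    have "L.le a ((a \<setminus>\<^bsub>L\<^esub> c) \<setminus>\<^bsub>L\<^esub> (a \<sqinter>\<^bsub>L\<^esub> c))"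
      by (simp add: L.le_relc_iff L.meet_relc closed)
    moreover have "L.le ((a \<setminus>\<^bsub>L\<^esub> c) \<sqinter>\<^bsub>L\<^esub> (b \<sqinter>\<^bsub>L\<^esub> d)) b"
      by (meson L.le_trans L.meet_le1 L.meet_le2 closed \<open>a \<in> _\<close> \<open>b \<in> _\<close> \<open>c \<in> _\<close> \<open>d \<in> _\<close>)
    ultimately show "x \<^bold>\<and>\<^bsub>product_bilat L\<^esub> ((x \<^bold>\<supset>\<^bsub>product_bilat L\<^esub> y) \<^bold>\<supset>\<^bsub>product_bilat L\<^esub>
        (x \<otimes>\<^bsub>product_bilat L\<^esub> y)) = x"
      by (simp add: xy L.le_iff_join L.join_commute closed) (simp add: L.le_def L.le_iff_join [symmetric] closed)
  qed (auto simp: closed kle_def L.relc_self L.one_relc L.relc_relc L.meet_assoc)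
qed

section \<open>The designated elements of an implicative bilattice\<close>

text \<open>
  In \<open>\<^bold>L \<odot> \<^bold>L\<close> the element \<open>\<langle>a, b\<rangle>\<close> is designated iff \<open>a = 1\<close>, and \<open>\<langle>a, b\<rangle> \<^bold>\<lesssim> \<langle>c, d\<rangle>\<close> iff
  \<open>a \<le> c\<close>.
\<close>

context implicative_bilattice
begin

definition des where "des d \<longleftrightarrow> d \<in> carrier B \<and> d \<^bold>\<supset> d = d"

definition ent (infix "\<^bold>\<lesssim>" 50) where "x \<^bold>\<lesssim> y \<longleftrightarrow> des (x \<^bold>\<supset> y)"

lemmas closed [simp, intro] = t.meet_closed t.join_closed k.meet_closed k.join_closed
  neg_closed impl_closed

lemma tle_iff: "x \<le>\<^sub>t y \<longleftrightarrow> t.le x y"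
  by (simp add: tle_def t.le_def)

lemma kle_iff: "x \<le>\<^sub>k y \<longleftrightarrow> k.le x y"
  by (simp add: kle_def k.le_def)

text \<open>(IB1) applies because \<open>d\<close> has the form \<open>d \<supset> d\<close>; a
  designated antecedent can therefore always be cancelled.\<close>

lemma des_impl: "\<lbrakk>des d; y \<in> carrier B\<rbrakk> \<Longrightarrow> d \<^bold>\<supset> y = y"
  unfolding des_def by (metis IB1)

lemma des_impl_self: "x \<in> carrier B \<Longrightarrow> des (x \<^bold>\<supset> x)"
  unfolding des_def using IB1 by auto

lemma impl_impl: "\<lbrakk>x \<in> carrier B; y \<in> carrier B; z \<in> carrier B\<rbrakk> \<Longrightarrow> x \<^bold>\<supset> (y \<^bold>\<supset> z) = (x \<^bold>\<and> y) \<^bold>\<supset> z"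
  and kmeet_impl: "\<lbrakk>x \<in> carrier B; y \<in> carrier B; z \<in> carrier B\<rbrakk> \<Longrightarrow> (x \<otimes> y) \<^bold>\<supset> z = (x \<^bold>\<and> y) \<^bold>\<supset> z"
  and tjoin_impl: "\<lbrakk>x \<in> carrier B; y \<in> carrier B; z \<in> carrier B\<rbrakk>
    \<Longrightarrow> (x \<^bold>\<or> y) \<^bold>\<supset> z = (x \<^bold>\<supset> z) \<^bold>\<and> (y \<^bold>\<supset> z)"
  and kjoin_impl: "\<lbrakk>x \<in> carrier B; y \<in> carrier B; z \<in> carrier B\<rbrakk>
    \<Longrightarrow> (x \<oplus> y) \<^bold>\<supset> z = (x \<^bold>\<supset> z) \<^bold>\<and> (y \<^bold>\<supset> z)"
  using IB2 IB4 by metis+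

lemma impl_exchange:
  "\<lbrakk>x \<in> carrier B; y \<in> carrier B; z \<in> carrier B\<rbrakk> \<Longrightarrow> x \<^bold>\<supset> (y \<^bold>\<supset> z) = y \<^bold>\<supset> (x \<^bold>\<supset> z)"
  by (metis impl_impl t.meet_commute)

lemma impl_contract: "\<lbrakk>x \<in> carrier B; y \<in> carrier B\<rbrakk> \<Longrightarrow> x \<^bold>\<supset> (x \<^bold>\<supset> y) = x \<^bold>\<supset> y"
  by (simp add: impl_impl)

text \<open>Weakening. For designated \<open>d\<close>, cancellation turns (IB3) at \<open>d\<close>
  and \<open>x\<close> into \<open>(x \<supset> d) \<supset> d = d\<close>; prefixing
  \<open>x\<close> and exchanging antecedents shows that \<open>x \<supset> d\<close> implies itself
  with value \<open>x \<supset> d\<close>.\<close>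

lemma ent_des:
  assumes "des d" "x \<in> carrier B"
  shows "x \<^bold>\<lesssim> d"
proof -
  have d: "d \<in> carrier B" "d \<^bold>\<supset> d = d"
    using assms by (auto simp: des_def)
  have "(x \<^bold>\<supset> d) \<^bold>\<supset> d = d"
    using IB3 [of d x] assms d by (simp add: des_impl)
  then have "(x \<^bold>\<supset> d) \<^bold>\<supset> (x \<^bold>\<supset> d) = x \<^bold>\<supset> d"
    using assms d by (simp add: impl_exchange [of _ x d])
  then show ?thesis
    using assms d by (simp add: ent_def des_def)
qed

lemma des_ent: "\<lbrakk>des d; d \<^bold>\<lesssim> x; x \<in> carrier B\<rbrakk> \<Longrightarrow> des x"
  by (simp add: ent_def des_impl)

lemma ent_refl [simp]: "x \<in> carrier B \<Longrightarrow> x \<^bold>\<lesssim> x"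
  by (simp add: ent_def des_impl_self)

text \<open>By currying, \<open>x \<and> y\<close> implies itself with value
  \<open>x \<supset> (y \<supset> (x \<and> y))\<close>, where designated \<open>x\<close> and
  \<open>y\<close> cancel. Conversely \<open>x \<and> y\<close> entails each factor by weakening
  from \<open>x \<supset> x\<close> and \<open>y \<supset> y\<close>.\<close>

lemma des_tmeet_iff:
  assumes "x \<in> carrier B" "y \<in> carrier B"
  shows "des (x \<^bold>\<and> y) \<longleftrightarrow> des x \<and> des y"
proof
  assume "des x \<and> des y"
  then show "des (x \<^bold>\<and> y)"
    using assms by (metis des_impl des_impl_self impl_impl closed(1))
next
  have "des (x \<^bold>\<and> y \<^bold>\<supset> x)" "des (x \<^bold>\<and> y \<^bold>\<supset> y)"
    using assms ent_des [OF des_impl_self, of x y] ent_des [OF des_impl_self, of y x]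
    by (simp_all add: ent_def impl_impl t.meet_commute [of x y])
  then show "des x \<and> des y" if "des (x \<^bold>\<and> y)"
    using that assms by (simp add: des_impl)
qed

lemma tmeet_ent1 [simp]: "\<lbrakk>x \<in> carrier B; y \<in> carrier B\<rbrakk> \<Longrightarrow> x \<^bold>\<and> y \<^bold>\<lesssim> x"
  and tmeet_ent2 [simp]: "\<lbrakk>x \<in> carrier B; y \<in> carrier B\<rbrakk> \<Longrightarrow> x \<^bold>\<and> y \<^bold>\<lesssim> y"
  using ent_des [OF des_impl_self, of x y] ent_des [OF des_impl_self, of y x]
  by (simp_all add: ent_def impl_impl t.meet_commute [of x y])

lemma kmeet_ent_iff:
  "\<lbrakk>x \<in> carrier B; y \<in> carrier B; z \<in> carrier B\<rbrakk> \<Longrightarrow> x \<otimes> y \<^bold>\<lesssim> z \<longleftrightarrow> x \<^bold>\<and> y \<^bold>\<lesssim> z"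
  by (simp add: ent_def kmeet_impl)

lemma tle_imp_ent: "\<lbrakk>t.le x y; x \<in> carrier B; y \<in> carrier B\<rbrakk> \<Longrightarrow> x \<^bold>\<lesssim> y"
  by (metis t.le_def tmeet_ent2)

lemma kle_imp_ent: "\<lbrakk>k.le x y; x \<in> carrier B; y \<in> carrier B\<rbrakk> \<Longrightarrow> x \<^bold>\<lesssim> y"
  by (metis k.le_def kmeet_ent_iff tmeet_ent2)

text \<open>The designated antecedent \<open>x \<supset> y\<close> cancels in (IB5). This is the
  passage from the preorder to the truth order.\<close>

lemma ent_imp_tle_kmeet:
  assumes "x \<^bold>\<lesssim> y" "x \<in> carrier B" "y \<in> carrier B"
  shows "t.le x (x \<otimes> y)"
  using assms IB5 [of x y] by (simp add: ent_def des_impl t.le_def)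

text \<open>The cut rule as an equation: \<open>x\<close> equals
  \<open>x \<and> (x \<otimes> y)\<close>, and (IB2) unfolds that antecedent into the successive
  antecedents \<open>x\<close>, \<open>x\<close>, \<open>y\<close>.\<close>

lemma ent_imp_impl_eq:
  assumes "x \<^bold>\<lesssim> y" "x \<in> carrier B" "y \<in> carrier B" "z \<in> carrier B"
  shows "x \<^bold>\<supset> (y \<^bold>\<supset> z) = x \<^bold>\<supset> z"
proof -
  have "x \<^bold>\<supset> z = (x \<^bold>\<and> (x \<otimes> y)) \<^bold>\<supset> z"
    using ent_imp_tle_kmeet assms by (simp add: t.le_def)
  also have "\<dots> = x \<^bold>\<supset> (x \<^bold>\<supset> (y \<^bold>\<supset> z))"
    using assms by (simp add: impl_impl [symmetric] kmeet_impl)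
  finally show ?thesis
    using assms by (simp add: impl_contract)
qed

text \<open>The designated \<open>y \<supset> z\<close> is entailed by \<open>x\<close>, and the cut
  equation removes \<open>y\<close> from \<open>x \<supset> (y \<supset> z)\<close>.\<close>

lemma ent_trans:
  "\<lbrakk>x \<^bold>\<lesssim> y; y \<^bold>\<lesssim> z; x \<in> carrier B; y \<in> carrier B; z \<in> carrier B\<rbrakk> \<Longrightarrow> x \<^bold>\<lesssim> z"
  by (metis ent_def ent_des ent_imp_impl_eq)

lemma ent_tmeet_iff [simp]:
  assumes "x \<in> carrier B" "y \<in> carrier B" "w \<in> carrier B"
  shows "w \<^bold>\<lesssim> x \<^bold>\<and> y \<longleftrightarrow> w \<^bold>\<lesssim> x \<and> w \<^bold>\<lesssim> y"
proof
  assume "w \<^bold>\<lesssim> x \<and> w \<^bold>\<lesssim> y"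
  \<comment> \<open>The cut equation is used backwards to insert the antecedents \<open>x\<close>
    and \<open>y\<close>; uncurried, what follows \<open>w\<close> is \<open>x \<and> y\<close>
    implying itself, which is designated.\<close>
  then have "w \<^bold>\<supset> (x \<^bold>\<and> y) = w \<^bold>\<supset> (x \<^bold>\<supset> (y \<^bold>\<supset> (x \<^bold>\<and> y)))"
    using assms by (metis closed(1,6) ent_imp_impl_eq impl_exchange)
  then show "w \<^bold>\<lesssim> x \<^bold>\<and> y"
    using assms ent_des [OF des_impl_self, of "x \<^bold>\<and> y" w] by (simp add: ent_def impl_impl)
qed (use assms in \<open>meson closed ent_trans tmeet_ent1 tmeet_ent2\<close>)

text \<open>By (IB2) the two meets are interchangeable as antecedents, so they entail each
  other.\<close>

lemma ent_kmeet_iff [simp]: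
  assumes "x \<in> carrier B" "y \<in> carrier B" "w \<in> carrier B"
  shows "w \<^bold>\<lesssim> x \<otimes> y \<longleftrightarrow> w \<^bold>\<lesssim> x \<and> w \<^bold>\<lesssim> y"
proof -
  have "x \<^bold>\<and> y \<^bold>\<lesssim> x \<otimes> y" "x \<otimes> y \<^bold>\<lesssim> x \<^bold>\<and> y"
    using assms kmeet_ent_iff [of x y "x \<otimes> y"] kmeet_ent_iff [of x y "x \<^bold>\<and> y"] by simp_all
  then have "w \<^bold>\<lesssim> x \<otimes> y \<longleftrightarrow> w \<^bold>\<lesssim> x \<^bold>\<and> y"
    using assms by (meson closed ent_trans)
  then show ?thesis
    using assms by simp
qed

lemma tjoin_ent_iff [simp]:
  "\<lbrakk>x \<in> carrier B; y \<in> carrier B; z \<in> carrier B\<rbrakk> \<Longrightarrow> x \<^bold>\<or> y \<^bold>\<lesssim> z \<longleftrightarrow> x \<^bold>\<lesssim> z \<and> y \<^bold>\<lesssim> z"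
  and kjoin_ent_iff [simp]:
  "\<lbrakk>x \<in> carrier B; y \<in> carrier B; z \<in> carrier B\<rbrakk> \<Longrightarrow> x \<oplus> y \<^bold>\<lesssim> z \<longleftrightarrow> x \<^bold>\<lesssim> z \<and> y \<^bold>\<lesssim> z"
  by (simp_all add: ent_def tjoin_impl kjoin_impl des_tmeet_iff)

lemma ent_tjoin1 [simp]: "\<lbrakk>x \<in> carrier B; y \<in> carrier B\<rbrakk> \<Longrightarrow> x \<^bold>\<lesssim> x \<^bold>\<or> y"
  and ent_tjoin2 [simp]: "\<lbrakk>x \<in> carrier B; y \<in> carrier B\<rbrakk> \<Longrightarrow> y \<^bold>\<lesssim> x \<^bold>\<or> y"
  and ent_kjoin1 [simp]: "\<lbrakk>x \<in> carrier B; y \<in> carrier B\<rbrakk> \<Longrightarrow> x \<^bold>\<lesssim> x \<oplus> y"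
  and ent_kjoin2 [simp]: "\<lbrakk>x \<in> carrier B; y \<in> carrier B\<rbrakk> \<Longrightarrow> y \<^bold>\<lesssim> x \<oplus> y"
  by (simp_all add: tle_imp_ent kle_imp_ent)

lemma ent_impl_iff [simp]:
  "\<lbrakk>x \<in> carrier B; y \<in> carrier B; w \<in> carrier B\<rbrakk> \<Longrightarrow> w \<^bold>\<lesssim> x \<^bold>\<supset> y \<longleftrightarrow> w \<^bold>\<and> x \<^bold>\<lesssim> y"
  by (simp add: ent_def impl_impl)

lemma neg_impl_ent_iff [simp]:
  "\<lbrakk>x \<in> carrier B; y \<in> carrier B; z \<in> carrier B\<rbrakk> \<Longrightarrow> \<^bold>\<not> (x \<^bold>\<supset> y) \<^bold>\<lesssim> z \<longleftrightarrow> x \<^bold>\<and> \<^bold>\<not> y \<^bold>\<lesssim> z"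
  by (simp add: ent_def IB6)

lemma ent_peirce: "\<lbrakk>x \<in> carrier B; y \<in> carrier B\<rbrakk> \<Longrightarrow> (x \<^bold>\<supset> y) \<^bold>\<supset> x \<^bold>\<lesssim> x"
  by (simp add: ent_def IB3 des_impl_self)

text \<open>Distributivity up to equivalence follows from residuation: once \<open>x\<close> is
  moved to the right, the join on the left splits into two cases.\<close>

lemma tmeet_tjoin_ent:
  assumes "x \<in> carrier B" "y \<in> carrier B" "z \<in> carrier B"
  shows "x \<^bold>\<and> (y \<^bold>\<or> z) \<^bold>\<lesssim> (x \<^bold>\<and> y) \<^bold>\<or> (x \<^bold>\<and> z)"
proof -
  have "y \<^bold>\<lesssim> x \<^bold>\<supset> (x \<^bold>\<and> y) \<^bold>\<or> (x \<^bold>\<and> z)" "z \<^bold>\<lesssim> x \<^bold>\<supset> (x \<^bold>\<and> y) \<^bold>\<or> (x \<^bold>\<and> z)"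
    using assms by (simp_all add: t.meet_commute [of y x] t.meet_commute [of z x])
  then have "y \<^bold>\<or> z \<^bold>\<lesssim> x \<^bold>\<supset> (x \<^bold>\<and> y) \<^bold>\<or> (x \<^bold>\<and> z)"
    using assms by (simp del: ent_impl_iff)
  then have "(y \<^bold>\<or> z) \<^bold>\<and> x \<^bold>\<lesssim> (x \<^bold>\<and> y) \<^bold>\<or> (x \<^bold>\<and> z)"
    using assms by (subst (asm) ent_impl_iff) auto
  then show ?thesis
    using assms by (simp add: t.meet_commute [of x "y \<^bold>\<or> z"])
qed

text \<open>Apply Peirce's law to \<open>x \<^bold>\<or> (x \<^bold>\<supset> y)\<close> and \<open>y\<close>.\<close>

lemma des_tjoin_impl:
  assumes "x \<in> carrier B" "y \<in> carrier B"
  shows "des (x \<^bold>\<or> (x \<^bold>\<supset> y))"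
proof -
  define e where "e = x \<^bold>\<or> (x \<^bold>\<supset> y)"
  have e: "e \<in> carrier B" "x \<^bold>\<lesssim> e" "x \<^bold>\<supset> y \<^bold>\<lesssim> e"
    using assms by (simp_all add: e_def del: ent_impl_iff)
  have "(e \<^bold>\<supset> y) \<^bold>\<and> e \<^bold>\<lesssim> y"
    using e assms by (subst ent_impl_iff [symmetric]) auto
  moreover have "(e \<^bold>\<supset> y) \<^bold>\<and> x \<^bold>\<lesssim> (e \<^bold>\<supset> y) \<^bold>\<and> e"
    using e assms by (simp del: ent_impl_iff) (meson closed ent_trans tmeet_ent1 tmeet_ent2)
  ultimately have "(e \<^bold>\<supset> y) \<^bold>\<and> x \<^bold>\<lesssim> y"
    using e assms by (meson closed ent_trans)
  then have "e \<^bold>\<supset> y \<^bold>\<lesssim> x \<^bold>\<supset> y"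
    using e assms by simp
  then have "e \<^bold>\<supset> y \<^bold>\<lesssim> e"
    using e assms by (meson closed ent_trans)
  then have "des ((e \<^bold>\<supset> y) \<^bold>\<supset> e)"
    by (simp add: ent_def)
  then show ?thesis
    using e assms ent_peirce des_ent unfolding e_def by blast
qed

section \<open>Negation and the truth order\<close>

lemmas [simp] = neg_neg

lemma tle_neg_iff: "\<lbrakk>x \<in> carrier B; y \<in> carrier B\<rbrakk> \<Longrightarrow> t.le (\<^bold>\<not> x) (\<^bold>\<not> y) \<longleftrightarrow> t.le y x"
  by (metis neg_closed neg_neg neg_t tle_iff)

lemma kle_neg_iff: "\<lbrakk>x \<in> carrier B; y \<in> carrier B\<rbrakk> \<Longrightarrow> k.le (\<^bold>\<not> x) (\<^bold>\<not> y) \<longleftrightarrow> k.le x y"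
  by (metis neg_closed neg_neg neg_k kle_iff)

text \<open>An order-reversing involution carries greatest lower bounds to least upper
  bounds.\<close>

lemma neg_tmeet:
  assumes "x \<in> carrier B" "y \<in> carrier B" shows "\<^bold>\<not> (x \<^bold>\<and> y) = \<^bold>\<not> x \<^bold>\<or> \<^bold>\<not> y"
proof (rule t.eq_joinI)
  fix w assume "w \<in> carrier B" "t.le (\<^bold>\<not> x) w" "t.le (\<^bold>\<not> y) w"
  then show "t.le (\<^bold>\<not> (x \<^bold>\<and> y)) w"
    using assms tle_neg_iff [of "x \<^bold>\<and> y" "\<^bold>\<not> w"] tle_neg_iff [of x "\<^bold>\<not> w"] tle_neg_iff [of y "\<^bold>\<not> w"]
    by simp
qed (use assms in \<open>simp_all add: tle_neg_iff\<close>)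

lemma neg_tjoin: "\<lbrakk>x \<in> carrier B; y \<in> carrier B\<rbrakk> \<Longrightarrow> \<^bold>\<not> (x \<^bold>\<or> y) = \<^bold>\<not> x \<^bold>\<and> \<^bold>\<not> y"
  using neg_tmeet [of "\<^bold>\<not> x" "\<^bold>\<not> y"] by (metis closed(1,5) neg_neg)

text \<open>For the knowledge order the involution is an automorphism, so here the operation is
  kept.\<close>

lemma neg_kmeet:
  assumes "x \<in> carrier B" "y \<in> carrier B" shows "\<^bold>\<not> (x \<otimes> y) = \<^bold>\<not> x \<otimes> \<^bold>\<not> y"
proof (rule k.eq_meetI)
  fix w assume "w \<in> carrier B" "k.le w (\<^bold>\<not> x)" "k.le w (\<^bold>\<not> y)"
  then show "k.le w (\<^bold>\<not> (x \<otimes> y))"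
    using assms kle_neg_iff [of "\<^bold>\<not> w" "x \<otimes> y"] kle_neg_iff [of "\<^bold>\<not> w" x] kle_neg_iff [of "\<^bold>\<not> w" y]
    by simp
qed (use assms in \<open>simp_all add: kle_neg_iff\<close>)

lemma neg_kjoin:
  assumes "x \<in> carrier B" "y \<in> carrier B" shows "\<^bold>\<not> (x \<oplus> y) = \<^bold>\<not> x \<oplus> \<^bold>\<not> y"
proof (rule k.eq_joinI)
  fix w assume "w \<in> carrier B" "k.le (\<^bold>\<not> x) w" "k.le (\<^bold>\<not> y) w"
  then show "k.le (\<^bold>\<not> (x \<oplus> y)) w"
    using assms kle_neg_iff [of "x \<oplus> y" "\<^bold>\<not> w"] kle_neg_iff [of x "\<^bold>\<not> w"] kle_neg_iff [of y "\<^bold>\<not> w"]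
    by simp
qed (use assms in \<open>simp_all add: kle_neg_iff\<close>)

text \<open>
  By (IB5), \<open>x \<^bold>\<lesssim> y\<close> gives \<open>x \<le>\<^sub>t x \<otimes> y\<close>; dually \<open>\<^bold>\<not> y \<^bold>\<lesssim> \<^bold>\<not> x\<close> gives \<open>x \<otimes> y \<le>\<^sub>t y\<close>.
\<close>

lemma tle_iff_ent:
  assumes "x \<in> carrier B" "y \<in> carrier B"
  shows "t.le x y \<longleftrightarrow> x \<^bold>\<lesssim> y \<and> \<^bold>\<not> y \<^bold>\<lesssim> \<^bold>\<not> x"
proof
  assume "t.le x y"
  then show "x \<^bold>\<lesssim> y \<and> \<^bold>\<not> y \<^bold>\<lesssim> \<^bold>\<not> x"
    using assms by (auto intro!: tle_imp_ent simp: tle_neg_iff)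
next
  assume *: "x \<^bold>\<lesssim> y \<and> \<^bold>\<not> y \<^bold>\<lesssim> \<^bold>\<not> x"
  then have "t.le (\<^bold>\<not> y) (\<^bold>\<not> (x \<otimes> y))"
    using ent_imp_tle_kmeet [of "\<^bold>\<not> y" "\<^bold>\<not> x"] assms by (simp add: neg_kmeet k.meet_commute)
  then have "t.le (x \<otimes> y) y"
    using assms by (simp add: tle_neg_iff)
  then show "t.le x y"
    using ent_imp_tle_kmeet [of x y] * assms by (meson closed t.le_trans)
qed


subsection \<open>The knowledge maximum\<close>

text \<open>Everything entails a designated element, so all entailments required by
  \<open>tle_iff_ent\<close> hold in both directions.\<close>

lemma ktop_unique:
  assumes "des c" "des (\<^bold>\<not> c)" "des d" "des (\<^bold>\<not> d)"
  shows "c = d"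
  using assms des_def by (intro t.le_antisym) (simp_all add: tle_iff_ent ent_des)

lemma ktop_term:
  assumes "x \<in> carrier B"
  shows "des ((x \<^bold>\<supset> x) \<oplus> \<^bold>\<not> (x \<^bold>\<supset> x))" "des (\<^bold>\<not> ((x \<^bold>\<supset> x) \<oplus> \<^bold>\<not> (x \<^bold>\<supset> x)))"
proof -
  show "des ((x \<^bold>\<supset> x) \<oplus> \<^bold>\<not> (x \<^bold>\<supset> x))"
    using assms des_ent [OF des_impl_self, of x] by simp
  \<comment> \<open>The term is its own negation, since negation commutes with
    \<open>\<oplus>\<close> and exchanges the two summands.\<close>
  then show "des (\<^bold>\<not> ((x \<^bold>\<supset> x) \<oplus> \<^bold>\<not> (x \<^bold>\<supset> x)))"
    using assms by (simp add: neg_kjoin k.join_commute)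
qed

text \<open>All values of the term are designated together with their negations, hence equal; this
  gives the definite description its value and lets \<open>x\<close> be chosen freely.\<close>

lemma ktop_eq:
  assumes "x \<in> carrier B"
  shows "\<^bold>\<top> = (x \<^bold>\<supset> x) \<oplus> \<^bold>\<not> (x \<^bold>\<supset> x)"
  unfolding ktop_def
proof (rule the_equality)
  fix c assume "\<exists>y\<in>carrier B. c = (y \<^bold>\<supset> y) \<oplus> \<^bold>\<not> (y \<^bold>\<supset> y)"
  then have "des c" "des (\<^bold>\<not> c)"
    using ktop_term by auto
  then show "c = (x \<^bold>\<supset> x) \<oplus> \<^bold>\<not> (x \<^bold>\<supset> x)"
    using ktop_unique ktop_term [OF assms] by blast
qed (use assms in blast)

lemma des_ktop [simp]: "des \<^bold>\<top>" "des (\<^bold>\<not> \<^bold>\<top>)"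
proof -
  obtain x where "x \<in> carrier B"
    using nonempty by blast
  then show "des \<^bold>\<top>" "des (\<^bold>\<not> \<^bold>\<top>)"
    using ktop_term [of x] ktop_eq [of x] by simp_all
qed

lemma ktop_closed [simp, intro]: "\<^bold>\<top> \<in> carrier B"
  using des_ktop des_def by blast

lemma ktop_eqI: "\<lbrakk>des d; des (\<^bold>\<not> d)\<rbrakk> \<Longrightarrow> \<^bold>\<top> = d"
  using ktop_unique by simp

lemma neg_ktop [simp]: "\<^bold>\<not> \<^bold>\<top> = \<^bold>\<top>"
  by (rule ktop_eqI [symmetric]) simp_all

lemma ent_ktop [simp]: "x \<in> carrier B \<Longrightarrow> x \<^bold>\<lesssim> \<^bold>\<top>"
  by (simp add: ent_des)

text \<open>Of the two conditions in \<open>tle_iff_ent\<close>, \<open>x \<lesssim> \<top>\<close>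
  always holds, and \<open>\<top>\<close> is its own negation. The elements below
  \<open>\<top>\<close> are thus those with designated negation.\<close>

lemma tle_ktop_iff: "x \<in> carrier B \<Longrightarrow> x \<le>\<^sub>t \<^bold>\<top> \<longleftrightarrow> \<^bold>\<top> \<^bold>\<lesssim> \<^bold>\<not> x"
  by (simp add: tle_iff tle_iff_ent)

text \<open>Below \<open>\<top>\<close> the negations are designated and so entail each other.
  Equations there reduce to two entailments.\<close>

lemma lower_eqI:
  "\<lbrakk>x \<^bold>\<lesssim> y; y \<^bold>\<lesssim> x; x \<in> carrier B; y \<in> carrier B; x \<le>\<^sub>t \<^bold>\<top>; y \<le>\<^sub>t \<^bold>\<top>\<rbrakk> \<Longrightarrow> x = y"
  by (intro t.le_antisym) (auto simp: tle_iff_ent tle_ktop_iff ent_des des_ent [OF des_ktop(1)])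

text \<open>These are modus ponens and excluded middle: up to equivalence,
  \<open>x \<supset> x \<and> a\<close> serves as a complement of \<open>x\<close> over
  \<open>a\<close>.\<close>

lemma ent_complement:
  assumes "a \<in> carrier B" "x \<in> carrier B"
  shows "x \<^bold>\<and> (x \<^bold>\<supset> x \<^bold>\<and> a) \<^bold>\<lesssim> a" "des (x \<^bold>\<or> (x \<^bold>\<supset> x \<^bold>\<and> a))"
proof -
  have "(x \<^bold>\<supset> x \<^bold>\<and> a) \<^bold>\<and> x \<^bold>\<lesssim> x \<^bold>\<and> a"
    using assms by (subst ent_impl_iff [symmetric]) auto
  then show "x \<^bold>\<and> (x \<^bold>\<supset> x \<^bold>\<and> a) \<^bold>\<lesssim> a"
    using assms by (simp add: t.meet_commute)
qed (use assms des_tjoin_impl in simp)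

text \<open>Cutting the complement down by an upper bound \<open>b\<close> keeps the join large
  enough: \<open>b\<close> entails \<open>b \<and> (x \<or> ?r)\<close>, which is then
  distributed.\<close>

lemma ent_relative_complement:
  assumes "a \<in> carrier B" "x \<in> carrier B" "b \<in> carrier B"
  shows "b \<^bold>\<lesssim> x \<^bold>\<or> b \<^bold>\<and> (x \<^bold>\<supset> x \<^bold>\<and> a)"
proof -
  let ?r = "x \<^bold>\<supset> x \<^bold>\<and> a"
  have "b \<^bold>\<lesssim> b \<^bold>\<and> (x \<^bold>\<or> ?r)"
    using assms ent_des [OF ent_complement(2)] by simp
  moreover have "b \<^bold>\<and> (x \<^bold>\<or> ?r) \<^bold>\<lesssim> (b \<^bold>\<and> x) \<^bold>\<or> (b \<^bold>\<and> ?r)"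
    using assms by (intro tmeet_tjoin_ent) auto
  moreover have "(b \<^bold>\<and> x) \<^bold>\<or> (b \<^bold>\<and> ?r) \<^bold>\<lesssim> x \<^bold>\<or> (b \<^bold>\<and> ?r)"
    using assms by (simp del: ent_impl_iff ent_tmeet_iff) (meson closed ent_trans ent_tjoin1 tmeet_ent2)
  ultimately show ?thesis
    using assms by (meson closed ent_trans)
qed

end

section \<open>The classical implicative lattice of the elements below \<top>\<close>

lemma lower_cilat_simps [simp]:
  "carrier (lower_cilat B) = {a \<in> carrier B. a \<le>\<^sub>t\<^bsub>B\<^esub> \<^bold>\<top>\<^bsub>B\<^esub>}"
  "a \<sqinter>\<^bsub>lower_cilat B\<^esub> b = a \<^bold>\<and>\<^bsub>B\<^esub> b"
  "a \<squnion>\<^bsub>lower_cilat B\<^esub> b = a \<^bold>\<or>\<^bsub>B\<^esub> b"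
  "a \<setminus>\<^bsub>lower_cilat B\<^esub> b = (a \<^bold>\<supset>\<^bsub>B\<^esub> (a \<^bold>\<and>\<^bsub>B\<^esub> b)) \<^bold>\<and>\<^bsub>B\<^esub> \<^bold>\<top>\<^bsub>B\<^esub>"
  "\<one>\<^bsub>lower_cilat B\<^esub> = \<^bold>\<top>\<^bsub>B\<^esub>"
  by (simp_all add: lower_cilat_def)

text \<open>The lattice laws are inherited from the truth lattice; distributivity and the complement
  laws hold up to equivalence and become equations by \<open>lower_eqI\<close>.\<close>

lemma classical_implicative_lattice_lower:
  assumes "implicative_bilattice B"
  shows "classical_implicative_lattice (lower_cilat B)"
proof -
  interpret B: implicative_bilattice B by fact
  have cle: "a \<sqsubseteq>\<^bsub>lower_cilat B\<^esub> b \<longleftrightarrow> B.t.le a b" for a b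
    by (simp add: cle_def B.t.le_def)
  have top_le: "B.t.le a \<^bold>\<top>\<^bsub>B\<^esub> \<Longrightarrow> B.t.le (a \<^bold>\<and>\<^bsub>B\<^esub> b) \<^bold>\<top>\<^bsub>B\<^esub>"
    if "a \<in> carrier B" "b \<in> carrier B" for a b
    using that by (meson B.closed B.ktop_closed B.t.le_trans B.t.meet_le1)
  show ?thesis
  proof unfold_locales
    fix x y z assume "x \<in> carrier (lower_cilat B)" "y \<in> carrier (lower_cilat B)"
      "z \<in> carrier (lower_cilat B)"
    then have *: "x \<in> carrier B" "y \<in> carrier B" "z \<in> carrier B"
      "B.t.le x \<^bold>\<top>\<^bsub>B\<^esub>" "B.t.le y \<^bold>\<top>\<^bsub>B\<^esub>" "B.t.le z \<^bold>\<top>\<^bsub>B\<^esub>"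
      by (auto simp: B.tle_iff)
    then have "x \<^bold>\<and>\<^bsub>B\<^esub> (y \<^bold>\<or>\<^bsub>B\<^esub> z) = (x \<^bold>\<and>\<^bsub>B\<^esub> y) \<^bold>\<or>\<^bsub>B\<^esub> (x \<^bold>\<and>\<^bsub>B\<^esub> z)"
      by (intro B.lower_eqI B.tmeet_tjoin_ent)
        (simp_all add: B.tle_iff top_le, (meson B.closed B.ent_trans B.ent_tjoin1 B.ent_tjoin2 B.tmeet_ent2)+)
    then show "x \<sqinter>\<^bsub>lower_cilat B\<^esub> (y \<squnion>\<^bsub>lower_cilat B\<^esub> z)
      = (x \<sqinter>\<^bsub>lower_cilat B\<^esub> y) \<squnion>\<^bsub>lower_cilat B\<^esub> (x \<sqinter>\<^bsub>lower_cilat B\<^esub> z)"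
      by simp
  next
    fix a b x assume "a \<in> carrier (lower_cilat B)" "b \<in> carrier (lower_cilat B)"
      "x \<in> carrier (lower_cilat B)" "a \<sqsubseteq>\<^bsub>lower_cilat B\<^esub> x" "x \<sqsubseteq>\<^bsub>lower_cilat B\<^esub> b"
    then have *: "a \<in> carrier B" "b \<in> carrier B" "x \<in> carrier B"
      "B.t.le a \<^bold>\<top>\<^bsub>B\<^esub>" "B.t.le b \<^bold>\<top>\<^bsub>B\<^esub>" "B.t.le x \<^bold>\<top>\<^bsub>B\<^esub>" "B.t.le a x" "B.t.le x b"
      by (auto simp: B.tle_iff cle)
    \<comment> \<open>The complement of \<open>x\<close> in the interval from \<open>a\<close> to
      \<open>b\<close> will be \<open>b \<and> r\<close>.\<close>
    define r where "r = x \<^bold>\<supset>\<^bsub>B\<^esub> x \<^bold>\<and>\<^bsub>B\<^esub> a"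
    have e: "B.ent a x" "B.ent x b" "B.ent a b"
      using * by (meson B.tle_imp_ent B.t.le_trans)+
    have r: "r \<in> carrier B" "B.ent a r" "B.ent (x \<^bold>\<and>\<^bsub>B\<^esub> r) a" "B.ent b (x \<^bold>\<or>\<^bsub>B\<^esub> b \<^bold>\<and>\<^bsub>B\<^esub> r)"
      using * e B.ent_complement [of a x] B.ent_relative_complement [of a x b] by (simp_all add: r_def)
    \<comment> \<open>The inequality is proved in its equational form, so that
      \<open>lower_eqI\<close> applies.\<close>
    have "a = a \<^bold>\<and>\<^bsub>B\<^esub> (b \<^bold>\<and>\<^bsub>B\<^esub> r)"
      using * e r by (intro B.lower_eqI) (simp_all add: B.tle_iff top_le)
    then have 1: "B.t.le a (b \<^bold>\<and>\<^bsub>B\<^esub> r)"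
      by (simp add: B.t.le_def)
    have 2: "x \<^bold>\<and>\<^bsub>B\<^esub> (b \<^bold>\<and>\<^bsub>B\<^esub> r) = a"
    proof (rule B.lower_eqI)
      have "B.ent (x \<^bold>\<and>\<^bsub>B\<^esub> (b \<^bold>\<and>\<^bsub>B\<^esub> r)) (x \<^bold>\<and>\<^bsub>B\<^esub> r)"
        using * e r by simp (meson B.closed B.ent_trans B.tmeet_ent2)
      then show "B.ent (x \<^bold>\<and>\<^bsub>B\<^esub> (b \<^bold>\<and>\<^bsub>B\<^esub> r)) a"
        using * e r by (meson B.closed B.ent_trans)
    qed (use * e r in \<open>simp_all add: B.tle_iff top_le\<close>)
    have 3: "x \<^bold>\<or>\<^bsub>B\<^esub> (b \<^bold>\<and>\<^bsub>B\<^esub> r) = b"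
      using * e r by (intro B.lower_eqI) (simp_all add: B.tle_iff top_le)
    show "\<exists>y. is_relative_complement (lower_cilat B) a b x y"
      unfolding is_relative_complement_def cle
      using * r 1 2 3 by (intro exI [of _ "b \<^bold>\<and>\<^bsub>B\<^esub> r"]) (simp add: B.tle_iff top_le)
  next
    fix a b assume "a \<in> carrier (lower_cilat B)" "b \<in> carrier (lower_cilat B)"
    then have *: "a \<in> carrier B" "b \<in> carrier B" "B.t.le a \<^bold>\<top>\<^bsub>B\<^esub>" "B.t.le b \<^bold>\<top>\<^bsub>B\<^esub>"
      by (auto simp: B.tle_iff)
    have "B.ent (a \<^bold>\<and>\<^bsub>B\<^esub> b \<^bold>\<and>\<^bsub>B\<^esub> a) b"
      using * by (meson B.closed B.ent_trans B.tmeet_ent1 B.tmeet_ent2)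
    \<comment> \<open>This is the previous construction for \<open>a\<close> in the interval from
      \<open>a \<and> b\<close> to \<open>\<top>\<close>, so the same complement lemmas
      apply.\<close>
    moreover define r where "r = a \<^bold>\<supset>\<^bsub>B\<^esub> a \<^bold>\<and>\<^bsub>B\<^esub> b"
    ultimately have r: "r \<in> carrier B" "B.ent (a \<^bold>\<and>\<^bsub>B\<^esub> b) r" "B.ent (a \<^bold>\<and>\<^bsub>B\<^esub> r) b"
      "B.ent \<^bold>\<top>\<^bsub>B\<^esub> (a \<^bold>\<or>\<^bsub>B\<^esub> \<^bold>\<top>\<^bsub>B\<^esub> \<^bold>\<and>\<^bsub>B\<^esub> r)"
      using * B.ent_complement [of b a] B.ent_relative_complement [of b a "\<^bold>\<top>\<^bsub>B\<^esub>"] by (simp_all add: r_def)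
    have 1: "a \<^bold>\<and>\<^bsub>B\<^esub> b \<^bold>\<and>\<^bsub>B\<^esub> (r \<^bold>\<and>\<^bsub>B\<^esub> \<^bold>\<top>\<^bsub>B\<^esub>) = a \<^bold>\<and>\<^bsub>B\<^esub> b"
    proof (rule B.lower_eqI)
      show "B.ent (a \<^bold>\<and>\<^bsub>B\<^esub> b \<^bold>\<and>\<^bsub>B\<^esub> (r \<^bold>\<and>\<^bsub>B\<^esub> \<^bold>\<top>\<^bsub>B\<^esub>)) (a \<^bold>\<and>\<^bsub>B\<^esub> b)"
        using * r by (intro B.tmeet_ent1) simp_all
    qed (use * r in \<open>simp_all add: B.tle_iff top_le\<close>)
    have 2: "a \<^bold>\<and>\<^bsub>B\<^esub> (r \<^bold>\<and>\<^bsub>B\<^esub> \<^bold>\<top>\<^bsub>B\<^esub>) = a \<^bold>\<and>\<^bsub>B\<^esub> b"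
    proof (rule B.lower_eqI)
      have "B.ent (a \<^bold>\<and>\<^bsub>B\<^esub> (r \<^bold>\<and>\<^bsub>B\<^esub> \<^bold>\<top>\<^bsub>B\<^esub>)) (a \<^bold>\<and>\<^bsub>B\<^esub> r)"
        using * r by simp (meson B.closed B.ktop_closed B.ent_trans B.tmeet_ent1 B.tmeet_ent2)
      then have "B.ent (a \<^bold>\<and>\<^bsub>B\<^esub> (r \<^bold>\<and>\<^bsub>B\<^esub> \<^bold>\<top>\<^bsub>B\<^esub>)) b"
        using * r by (meson B.closed B.ktop_closed B.ent_trans)
      then show "B.ent (a \<^bold>\<and>\<^bsub>B\<^esub> (r \<^bold>\<and>\<^bsub>B\<^esub> \<^bold>\<top>\<^bsub>B\<^esub>)) (a \<^bold>\<and>\<^bsub>B\<^esub> b)"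
        using * r by simp
    qed (use * r in \<open>simp_all add: B.tle_iff top_le\<close>)
    have 3: "a \<^bold>\<or>\<^bsub>B\<^esub> (r \<^bold>\<and>\<^bsub>B\<^esub> \<^bold>\<top>\<^bsub>B\<^esub>) = \<^bold>\<top>\<^bsub>B\<^esub>"
      using * r by (intro B.lower_eqI) (simp_all add: B.tle_iff top_le B.t.meet_commute [of r])
    show "is_relative_complement (lower_cilat B) (a \<sqinter>\<^bsub>lower_cilat B\<^esub> b) \<one>\<^bsub>lower_cilat B\<^esub> a
        (a \<setminus>\<^bsub>lower_cilat B\<^esub> b)"
      unfolding is_relative_complement_def cle
      using * r 2 3 1 [folded B.t.le_def] by (simp add: B.tle_iff top_le r_def [symmetric])
  qed (auto simp: B.tle_iff cle top_le B.t.meet_join_absorb B.t.join_meet_absorb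
      intro: B.t.meet_commute B.t.join_commute B.t.meet_assoc B.t.join_assoc)
qed

section \<open>Functors, and isomorphisms as bijective homomorphisms\<close>

lemma is_functor_id: "is_category C \<Longrightarrow> is_functor C C id_functor"
  by (simp add: is_functor_def id_functor_def)

lemma is_functor_comp:
  "\<lbrakk>is_functor C D T; is_functor D E S\<rbrakk> \<Longrightarrow> is_functor C E (S \<circ>\<^sub>F T)"
  by (simp add: is_functor_def comp_functor_def)

section \<open>Homomorphisms and isomorphisms in the two categories\<close>

lemma CILat_simps [simp]:
  "Obj CILat = {L. classical_implicative_lattice L}" "Hom CILat = cilat_hom"
  "Idn CILat L = (\<lambda>a\<in>carrier L. a)" "Cmp CILat L M N g f = compose (carrier L) g f"
  by (simp_all add: CILat_def)

lemma ImpBiLat_simps [simp]: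
  "Obj ImpBiLat = {B. implicative_bilattice B}" "Hom ImpBiLat = imp_bilat_hom"
  "Idn ImpBiLat B = (\<lambda>a\<in>carrier B. a)" "Cmp ImpBiLat A B C g f = compose (carrier A) g f"
  by (simp_all add: ImpBiLat_def)

lemma cilat_hom_closed: "\<lbrakk>h \<in> cilat_hom L M; a \<in> carrier L\<rbrakk> \<Longrightarrow> h a \<in> carrier M"
  by (auto simp: cilat_hom_def)

lemma imp_bilat_hom_closed: "\<lbrakk>h \<in> imp_bilat_hom A B; a \<in> carrier A\<rbrakk> \<Longrightarrow> h a \<in> carrier B"
  by (auto simp: imp_bilat_hom_def)

lemma cilat_hom_funcset: "h \<in> cilat_hom L M \<Longrightarrow> h \<in> carrier L \<rightarrow> carrier M"
  and cilat_hom_extensional: "h \<in> cilat_hom L M \<Longrightarrow> h \<in> extensional (carrier L)"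
  by (simp_all add: cilat_hom_def PiE_iff Pi_iff)

lemma imp_bilat_hom_funcset: "h \<in> imp_bilat_hom A B \<Longrightarrow> h \<in> carrier A \<rightarrow> carrier B"
  and imp_bilat_hom_extensional: "h \<in> imp_bilat_hom A B \<Longrightarrow> h \<in> extensional (carrier A)"
  by (simp_all add: imp_bilat_hom_def PiE_iff Pi_iff)

lemma cilat_hom_simps:
  assumes "h \<in> cilat_hom L M" "a \<in> carrier L" "b \<in> carrier L"
  shows "h (a \<sqinter>\<^bsub>L\<^esub> b) = h a \<sqinter>\<^bsub>M\<^esub> h b"
    "h (a \<squnion>\<^bsub>L\<^esub> b) = h a \<squnion>\<^bsub>M\<^esub> h b"
    "h (a \<setminus>\<^bsub>L\<^esub> b) = h a \<setminus>\<^bsub>M\<^esub> h b"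
  using assms by (simp_all add: cilat_hom_def)

lemma cilat_homI:
  assumes "h \<in> extensional (carrier L)" "\<And>a. a \<in> carrier L \<Longrightarrow> h a \<in> carrier M"
    and "\<And>a b. \<lbrakk>a \<in> carrier L; b \<in> carrier L\<rbrakk> \<Longrightarrow> h (a \<sqinter>\<^bsub>L\<^esub> b) = h a \<sqinter>\<^bsub>M\<^esub> h b"
    and "\<And>a b. \<lbrakk>a \<in> carrier L; b \<in> carrier L\<rbrakk> \<Longrightarrow> h (a \<squnion>\<^bsub>L\<^esub> b) = h a \<squnion>\<^bsub>M\<^esub> h b"
    and "\<And>a b. \<lbrakk>a \<in> carrier L; b \<in> carrier L\<rbrakk> \<Longrightarrow> h (a \<setminus>\<^bsub>L\<^esub> b) = h a \<setminus>\<^bsub>M\<^esub> h b"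
    and "h \<one>\<^bsub>L\<^esub> = \<one>\<^bsub>M\<^esub>"
  shows "h \<in> cilat_hom L M"
  using assms by (simp add: cilat_hom_def PiE_iff)

lemma cilat_hom_one: "h \<in> cilat_hom L M \<Longrightarrow> h \<one>\<^bsub>L\<^esub> = \<one>\<^bsub>M\<^esub>"
  by (simp add: cilat_hom_def)

lemma imp_bilat_hom_simps:
  assumes "h \<in> imp_bilat_hom A B" "a \<in> carrier A" "b \<in> carrier A"
  shows "h (a \<^bold>\<and>\<^bsub>A\<^esub> b) = h a \<^bold>\<and>\<^bsub>B\<^esub> h b"
    "h (a \<^bold>\<or>\<^bsub>A\<^esub> b) = h a \<^bold>\<or>\<^bsub>B\<^esub> h b"
    "h (a \<otimes>\<^bsub>A\<^esub> b) = h a \<otimes>\<^bsub>B\<^esub> h b"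
    "h (a \<oplus>\<^bsub>A\<^esub> b) = h a \<oplus>\<^bsub>B\<^esub> h b"
    "h (a \<^bold>\<supset>\<^bsub>A\<^esub> b) = h a \<^bold>\<supset>\<^bsub>B\<^esub> h b"
  using assms by (simp_all add: imp_bilat_hom_def)

lemma imp_bilat_hom_neg:
  "\<lbrakk>h \<in> imp_bilat_hom A B; a \<in> carrier A\<rbrakk> \<Longrightarrow> h (\<^bold>\<not>\<^bsub>A\<^esub> a) = \<^bold>\<not>\<^bsub>B\<^esub> (h a)"
  by (simp add: imp_bilat_hom_def)

lemma imp_bilat_homI:
  assumes "h \<in> extensional (carrier A)" "\<And>a. a \<in> carrier A \<Longrightarrow> h a \<in> carrier B"
    and "\<And>a b. \<lbrakk>a \<in> carrier A; b \<in> carrier A\<rbrakk> \<Longrightarrow> h (a \<^bold>\<and>\<^bsub>A\<^esub> b) = h a \<^bold>\<and>\<^bsub>B\<^esub> h b"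
    and "\<And>a b. \<lbrakk>a \<in> carrier A; b \<in> carrier A\<rbrakk> \<Longrightarrow> h (a \<^bold>\<or>\<^bsub>A\<^esub> b) = h a \<^bold>\<or>\<^bsub>B\<^esub> h b"
    and "\<And>a b. \<lbrakk>a \<in> carrier A; b \<in> carrier A\<rbrakk> \<Longrightarrow> h (a \<otimes>\<^bsub>A\<^esub> b) = h a \<otimes>\<^bsub>B\<^esub> h b"
    and "\<And>a b. \<lbrakk>a \<in> carrier A; b \<in> carrier A\<rbrakk> \<Longrightarrow> h (a \<oplus>\<^bsub>A\<^esub> b) = h a \<oplus>\<^bsub>B\<^esub> h b"
    and "\<And>a b. \<lbrakk>a \<in> carrier A; b \<in> carrier A\<rbrakk> \<Longrightarrow> h (a \<^bold>\<supset>\<^bsub>A\<^esub> b) = h a \<^bold>\<supset>\<^bsub>B\<^esub> h b"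
    and "\<And>a. a \<in> carrier A \<Longrightarrow> h (\<^bold>\<not>\<^bsub>A\<^esub> a) = \<^bold>\<not>\<^bsub>B\<^esub> (h a)"
  shows "h \<in> imp_bilat_hom A B"
  using assms by (simp add: imp_bilat_hom_def PiE_iff)

lemma cilat_hom_compose:
  assumes "classical_implicative_lattice L" "f \<in> cilat_hom L M" "g \<in> cilat_hom M N"
  shows "compose (carrier L) g f \<in> cilat_hom L N"
proof -
  interpret L: classical_implicative_lattice L by fact
  show ?thesis
    using assms
    by (intro cilat_homI) (simp_all add: compose_def cilat_hom_simps [OF assms(2)]
        cilat_hom_simps [OF assms(3)] cilat_hom_one cilat_hom_closed L.closed L.relc_closed)
qed

lemma imp_bilat_hom_compose:
  assumes "implicative_bilattice A" "f \<in> imp_bilat_hom A B" "g \<in> imp_bilat_hom B C"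
  shows "compose (carrier A) g f \<in> imp_bilat_hom A C"
proof -
  interpret A: implicative_bilattice A by fact
  show ?thesis
    using assms
    by (intro imp_bilat_homI) (simp_all add: compose_def imp_bilat_hom_simps [OF assms(2)]
        imp_bilat_hom_simps [OF assms(3)] imp_bilat_hom_neg imp_bilat_hom_closed)
qed

lemma is_category_CILat: "is_category CILat"
  unfolding is_category_def
proof (simp, intro conjI allI impI ballI)
  fix L :: "'a cilat" assume "classical_implicative_lattice L"
  then interpret classical_implicative_lattice L .
  show "(\<lambda>a\<in>carrier L. a) \<in> cilat_hom L L"
    by (simp add: cilat_hom_def closed relc_closed)
qed (auto intro: cilat_hom_compose compose_Id cilat_hom_funcset cilat_hom_extensional
    simp: Id_compose compose_assoc [symmetric] cilat_hom_funcset cilat_hom_extensional)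

lemma is_category_ImpBiLat: "is_category ImpBiLat"
  unfolding is_category_def
proof (simp, intro conjI allI impI ballI)
  fix B :: "'a imp_bilat" assume "implicative_bilattice B"
  then interpret implicative_bilattice B .
  show "(\<lambda>a\<in>carrier B. a) \<in> imp_bilat_hom B B"
    by (simp add: imp_bilat_hom_def)
qed (auto intro: imp_bilat_hom_compose compose_Id imp_bilat_hom_funcset imp_bilat_hom_extensional
    simp: Id_compose compose_assoc [symmetric] imp_bilat_hom_funcset imp_bilat_hom_extensional)

text \<open>The inverse map preserves the operations because every element of \<open>M\<close> is an
  image under \<open>h\<close>, and an operation on images is the image of the operation.\<close>

lemma is_isomorphism_CILat:
  assumes "classical_implicative_lattice L" "h \<in> cilat_hom L M" "bij_betw h (carrier L) (carrier M)"
  shows "is_isomorphism CILat L M h"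
proof -
  interpret L: classical_implicative_lattice L by fact
  \<comment> \<open>The restriction makes the inverse \<open>undefined\<close> outside the carrier
    of \<open>M\<close>, as arrows must be.\<close>
  define k where "k = (\<lambda>y\<in>carrier M. inv_into (carrier L) h y)"
  have kh: "k (h x) = x" if "x \<in> carrier L" for x
    using that assms bij_betwE by (fastforce simp: k_def bij_betw_inv_into_left)
  have hk: "k y \<in> carrier L" "h (k y) = y" if "y \<in> carrier M" for y
    using that assms(3) by (auto simp: k_def bij_betw_inv_into_right bij_betw_def inv_into_into)
  have "k \<in> cilat_hom M L"
    unfolding cilat_hom_def
  proof (intro CollectI conjI ballI)
    have "k (h \<one>\<^bsub>L\<^esub>) = \<one>\<^bsub>L\<^esub>"
      by (simp add: kh L.one_closed)
    then show "k \<one>\<^bsub>M\<^esub> = \<one>\<^bsub>L\<^esub>"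
      using assms(2) by (simp add: cilat_hom_def)
  next
    fix a b assume "a \<in> carrier M" "b \<in> carrier M"
    then obtain x y where "x \<in> carrier L" "y \<in> carrier L" "a = h x" "b = h y"
      by (metis hk)
    then show "k (a \<sqinter>\<^bsub>M\<^esub> b) = k a \<sqinter>\<^bsub>L\<^esub> k b" "k (a \<squnion>\<^bsub>M\<^esub> b) = k a \<squnion>\<^bsub>L\<^esub> k b"
      "k (a \<setminus>\<^bsub>M\<^esub> b) = k a \<setminus>\<^bsub>L\<^esub> k b"
      using assms(2) kh [of "x \<sqinter>\<^bsub>L\<^esub> y"] kh [of "x \<squnion>\<^bsub>L\<^esub> y"] kh [of "x \<setminus>\<^bsub>L\<^esub> y"]
      by (simp_all add: cilat_hom_def kh L.closed L.relc_closed)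
  qed (use hk in \<open>auto simp: k_def\<close>)
  then show ?thesis
    using assms(2) kh hk cilat_hom_closed
    by (fastforce simp: is_isomorphism_def compose_def intro!: bexI [of _ k] restrict_ext)
qed

lemma is_isomorphism_ImpBiLat:
  assumes "implicative_bilattice A" "h \<in> imp_bilat_hom A B" "bij_betw h (carrier A) (carrier B)"
  shows "is_isomorphism ImpBiLat A B h"
proof -
  interpret A: implicative_bilattice A by fact
  define k where "k = (\<lambda>y\<in>carrier B. inv_into (carrier A) h y)"
  have kh: "k (h x) = x" if "x \<in> carrier A" for x
    using that assms bij_betwE by (fastforce simp: k_def bij_betw_inv_into_left)
  have hk: "k y \<in> carrier A" "h (k y) = y" if "y \<in> carrier B" for y
    using that assms(3) by (auto simp: k_def bij_betw_inv_into_right bij_betw_def inv_into_into)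
  have "k \<in> imp_bilat_hom B A"
    unfolding imp_bilat_hom_def
  proof (intro CollectI conjI ballI)
    fix a assume "a \<in> carrier B"
    then obtain x where "x \<in> carrier A" "a = h x"
      by (metis hk)
    then show "k (\<^bold>\<not>\<^bsub>B\<^esub> a) = \<^bold>\<not>\<^bsub>A\<^esub> (k a)"
      using assms(2) kh [of "\<^bold>\<not>\<^bsub>A\<^esub> x"] by (simp add: imp_bilat_hom_def kh)
  next
    fix a b assume "a \<in> carrier B" "b \<in> carrier B"
    then obtain x y where "x \<in> carrier A" "y \<in> carrier A" "a = h x" "b = h y"
      by (metis hk)
    then show "k (a \<^bold>\<and>\<^bsub>B\<^esub> b) = k a \<^bold>\<and>\<^bsub>A\<^esub> k b" "k (a \<^bold>\<or>\<^bsub>B\<^esub> b) = k a \<^bold>\<or>\<^bsub>A\<^esub> k b"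
      "k (a \<otimes>\<^bsub>B\<^esub> b) = k a \<otimes>\<^bsub>A\<^esub> k b" "k (a \<oplus>\<^bsub>B\<^esub> b) = k a \<oplus>\<^bsub>A\<^esub> k b"
      "k (a \<^bold>\<supset>\<^bsub>B\<^esub> b) = k a \<^bold>\<supset>\<^bsub>A\<^esub> k b"
      using assms(2) kh [of "x \<^bold>\<and>\<^bsub>A\<^esub> y"] kh [of "x \<^bold>\<or>\<^bsub>A\<^esub> y"] kh [of "x \<otimes>\<^bsub>A\<^esub> y"]
        kh [of "x \<oplus>\<^bsub>A\<^esub> y"] kh [of "x \<^bold>\<supset>\<^bsub>A\<^esub> y"]
      by (simp_all add: imp_bilat_hom_def kh)
  qed (use hk in \<open>auto simp: k_def\<close>)
  then show ?thesis
    using assms(2) kh hk imp_bilat_hom_closed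
    by (fastforce simp: is_isomorphism_def compose_def intro!: bexI [of _ k] restrict_ext)
qed


section \<open>The equivalence\<close>

lemma is_functor_F: "is_functor CILat ImpBiLat functor_F"
  unfolding is_functor_def
proof (simp add: is_category_CILat is_category_ImpBiLat functor_F_def implicative_bilattice_product,
    intro conjI allI impI ballI)
  fix L M :: "'a univ cilat" and h
  assume "classical_implicative_lattice L" and h: "h \<in> cilat_hom L M"
  then interpret classical_implicative_lattice L by simp
  show "(\<lambda>x\<in>carrier (product_bilat L). \<langle>h (ufst x), h (usnd x)\<rangle>)
      \<in> imp_bilat_hom (product_bilat L) (product_bilat M)"
    by (rule imp_bilat_homI) (auto simp: cilat_hom_simps [OF h] cilat_hom_closed [OF h] closed relc_closed)
qed (auto simp: compose_def cilat_hom_closed intro!: restrict_ext)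

text \<open>Although \<open>\<top>\<close> is not in the signature, it is the value of a term at any
  element, and the carrier is nonempty.\<close>

lemma imp_bilat_hom_ktop:
  assumes "implicative_bilattice A" "implicative_bilattice B" "k \<in> imp_bilat_hom A B"
  shows "k \<^bold>\<top>\<^bsub>A\<^esub> = \<^bold>\<top>\<^bsub>B\<^esub>"
proof -
  interpret A: implicative_bilattice A by fact
  interpret B: implicative_bilattice B by fact
  obtain x where "x \<in> carrier A"
    using A.nonempty by blast
  with assms(3) show ?thesis
    by (simp add: A.ktop_eq [of x] B.ktop_eq [of "k x"] imp_bilat_hom_closed)
      (simp add: imp_bilat_hom_def)
qed

text \<open>This makes the action of \<open>functor_G\<close> on arrows land in the right
  carrier.\<close>

lemma imp_bilat_hom_lower:
  assumes "implicative_bilattice A" "implicative_bilattice B" "k \<in> imp_bilat_hom A B"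
    and "a \<in> carrier A" "a \<le>\<^sub>t\<^bsub>A\<^esub> \<^bold>\<top>\<^bsub>A\<^esub>"
  shows "k a \<le>\<^sub>t\<^bsub>B\<^esub> \<^bold>\<top>\<^bsub>B\<^esub>"
proof -
  have "k (a \<^bold>\<and>\<^bsub>A\<^esub> \<^bold>\<top>\<^bsub>A\<^esub>) = k a \<^bold>\<and>\<^bsub>B\<^esub> k \<^bold>\<top>\<^bsub>A\<^esub>"
    using assms implicative_bilattice.ktop_closed [OF assms(1)] by (simp add: imp_bilat_hom_def)
  then show ?thesis
    using assms(5) imp_bilat_hom_ktop [OF assms(1-3)] by (simp add: tle_def)
qed

lemma is_functor_G: "is_functor ImpBiLat CILat functor_G"
  unfolding is_functor_def
proof (simp add: is_category_CILat is_category_ImpBiLat functor_G_def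
    classical_implicative_lattice_lower del: lower_cilat_simps(1), intro conjI allI impI ballI)
  fix A B :: "'a imp_bilat" and k
  assume A: "implicative_bilattice A" and B: "implicative_bilattice B" and k: "k \<in> imp_bilat_hom A B"
  interpret A: implicative_bilattice A by fact
  interpret L: classical_implicative_lattice "lower_cilat A"
    by (rule classical_implicative_lattice_lower) fact
  note top = imp_bilat_hom_ktop [OF A B k] and lower = imp_bilat_hom_lower [OF A B k]
  have mem: "k a \<in> carrier (lower_cilat B)" if "a \<in> carrier (lower_cilat A)" for a
    using that k lower by (simp add: imp_bilat_hom_closed)
  \<comment> \<open>The relative complement is a term in the truth meet, the implication and
    \<open>\<top>\<close>, all of which \<open>k\<close> preserves.\<close>
  have ops: "k (a \<sqinter>\<^bsub>lower_cilat A\<^esub> b) = k a \<sqinter>\<^bsub>lower_cilat B\<^esub> k b"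
    "k (a \<squnion>\<^bsub>lower_cilat A\<^esub> b) = k a \<squnion>\<^bsub>lower_cilat B\<^esub> k b"
    "k (a \<setminus>\<^bsub>lower_cilat A\<^esub> b) = k a \<setminus>\<^bsub>lower_cilat B\<^esub> k b"
    if "a \<in> carrier (lower_cilat A)" "b \<in> carrier (lower_cilat A)" for a b
    using that k by (simp_all add: imp_bilat_hom_def top)
  show "(\<lambda>a\<in>carrier (lower_cilat A). k a) \<in> cilat_hom (lower_cilat A) (lower_cilat B)"
    unfolding cilat_hom_def
    using mem ops top L.closed L.relc_closed by (simp del: lower_cilat_simps(1-4))
next
  fix A B C :: "'a imp_bilat" and f g
  assume "implicative_bilattice A" "implicative_bilattice B" "f \<in> imp_bilat_hom A B"
  \<comment> \<open>The restriction of \<open>g\<close> does no harm, since \<open>f\<close> sends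
    elements below \<open>\<top>\<close> to elements below \<open>\<top>\<close>.\<close>
  then show "restrict (compose (carrier A) g f) (carrier (lower_cilat A)) =
      compose (carrier (lower_cilat A)) (restrict g (carrier (lower_cilat B)))
        (restrict f (carrier (lower_cilat A)))"
    by (auto simp: compose_def imp_bilat_hom_closed imp_bilat_hom_lower intro!: restrict_ext)
qed auto

section \<open>The isomorphism f from a bilattice to its product representation\<close>

context
  fixes B :: "'a univ imp_bilat" (structure)
  assumes B: "implicative_bilattice B"
begin

interpretation implicative_bilattice B by (fact B)

lemma tmeet_ktop_lower: "x \<in> carrier B \<Longrightarrow> x \<^bold>\<and> \<^bold>\<top> \<le>\<^sub>t \<^bold>\<top>"
  by (simp add: tle_iff)

text \<open>Meeting with \<open>\<top>\<close> does not change the equivalence class, because every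
  element entails \<open>\<top>\<close>.\<close>

lemma ent_tmeet_ktop_left [simp]:
  "\<lbrakk>x \<in> carrier B; y \<in> carrier B\<rbrakk> \<Longrightarrow> ent (x \<^bold>\<and> \<^bold>\<top>) y \<longleftrightarrow> ent x y"
  by (metis closed(1) ent_ktop ent_refl ent_tmeet_iff ent_trans ktop_closed)

lemma ent_tmeet_ktop_meet [simp]:
  assumes "x \<in> carrier B" "y \<in> carrier B" "z \<in> carrier B"
  shows "ent (x \<^bold>\<and> \<^bold>\<top> \<^bold>\<and> y) z \<longleftrightarrow> ent (x \<^bold>\<and> y) z" "ent (y \<^bold>\<and> (x \<^bold>\<and> \<^bold>\<top>)) z \<longleftrightarrow> ent (y \<^bold>\<and> x) z"
proof -
  have "x \<^bold>\<and> \<^bold>\<top> \<^bold>\<and> y = x \<^bold>\<and> y \<^bold>\<and> \<^bold>\<top>" "y \<^bold>\<and> (x \<^bold>\<and> \<^bold>\<top>) = y \<^bold>\<and> x \<^bold>\<and> \<^bold>\<top>"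
    using assms by (simp_all add: t.meet_assoc t.meet_commute [of "\<^bold>\<top>" y])
  then show "ent (x \<^bold>\<and> \<^bold>\<top> \<^bold>\<and> y) z \<longleftrightarrow> ent (x \<^bold>\<and> y) z" "ent (y \<^bold>\<and> (x \<^bold>\<and> \<^bold>\<top>)) z \<longleftrightarrow> ent (y \<^bold>\<and> x) z"
    using assms by simp_all
qed

lemma ent_tmeet_ktop_join [simp]:
  assumes "x \<in> carrier B" "y \<in> carrier B" "z \<in> carrier B" "ent z x"
  shows "ent z (x \<^bold>\<and> \<^bold>\<top> \<^bold>\<or> y)" "ent z (y \<^bold>\<or> (x \<^bold>\<and> \<^bold>\<top>))"
  using assms ent_trans [of z "x \<^bold>\<and> \<^bold>\<top>" "x \<^bold>\<and> \<^bold>\<top> \<^bold>\<or> y"] ent_trans [of z "x \<^bold>\<and> \<^bold>\<top>" "y \<^bold>\<or> (x \<^bold>\<and> \<^bold>\<top>)"]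
  by simp_all

text \<open>Passing to representatives below \<open>\<top>\<close> identifies the two meets and the
  two joins. The second components follow from the laws for negation, which exchange truth meet and
  join but keep the knowledge operations.\<close>

lemma family_f_hom: "family_f B \<in> imp_bilat_hom B (product_bilat (lower_cilat B))"
proof -
  have p: "(x \<^bold>\<and> y) \<^bold>\<and> \<^bold>\<top> = (x \<^bold>\<and> \<^bold>\<top>) \<^bold>\<and> (y \<^bold>\<and> \<^bold>\<top>)"
    "(x \<otimes> y) \<^bold>\<and> \<^bold>\<top> = (x \<^bold>\<and> \<^bold>\<top>) \<^bold>\<and> (y \<^bold>\<and> \<^bold>\<top>)"
    "(x \<^bold>\<or> y) \<^bold>\<and> \<^bold>\<top> = (x \<^bold>\<and> \<^bold>\<top>) \<^bold>\<or> (y \<^bold>\<and> \<^bold>\<top>)"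
    "(x \<oplus> y) \<^bold>\<and> \<^bold>\<top> = (x \<^bold>\<and> \<^bold>\<top>) \<^bold>\<or> (y \<^bold>\<and> \<^bold>\<top>)"
    "(x \<^bold>\<supset> y) \<^bold>\<and> \<^bold>\<top> = ((x \<^bold>\<and> \<^bold>\<top>) \<^bold>\<supset> (x \<^bold>\<and> \<^bold>\<top>) \<^bold>\<and> (y \<^bold>\<and> \<^bold>\<top>)) \<^bold>\<and> \<^bold>\<top>"
    "\<^bold>\<not> (x \<^bold>\<supset> y) \<^bold>\<and> \<^bold>\<top> = (x \<^bold>\<and> \<^bold>\<top>) \<^bold>\<and> (\<^bold>\<not> y \<^bold>\<and> \<^bold>\<top>)"
    if xy: "x \<in> carrier B" "y \<in> carrier B" for x y
  proof -
    have mp: "ent ((z \<^bold>\<supset> w) \<^bold>\<and> z) w" if "z \<in> carrier B" "w \<in> carrier B" for z w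
      using that by (subst ent_impl_iff [symmetric]) auto
    \<comment> \<open>This is (IB6) with \<open>\<not> (x \<supset> y)\<close> itself as the
      conclusion.\<close>
    have n: "ent (x \<^bold>\<and> \<^bold>\<not> y) (\<^bold>\<not> (x \<^bold>\<supset> y))"
      using xy by (subst neg_impl_ent_iff [symmetric]) auto
    have "ent (((x \<^bold>\<and> \<^bold>\<top>) \<^bold>\<supset> (x \<^bold>\<and> \<^bold>\<top>) \<^bold>\<and> (y \<^bold>\<and> \<^bold>\<top>)) \<^bold>\<and> x) y"
      using mp [of "x \<^bold>\<and> \<^bold>\<top>" "(x \<^bold>\<and> \<^bold>\<top>) \<^bold>\<and> (y \<^bold>\<and> \<^bold>\<top>)"] xy by simp
    moreover have "x \<^bold>\<and> \<^bold>\<top> \<^bold>\<and> (y \<^bold>\<and> \<^bold>\<top>) \<le>\<^sub>t \<^bold>\<top>" "x \<^bold>\<and> \<^bold>\<top> \<^bold>\<or> (y \<^bold>\<and> \<^bold>\<top>) \<le>\<^sub>t \<^bold>\<top>"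
      using xy by (auto simp: tle_iff intro: t.le_trans [OF t.meet_le1])
    moreover have "x \<^bold>\<and> \<^bold>\<top> \<^bold>\<and> (\<^bold>\<not> y \<^bold>\<and> \<^bold>\<top>) \<le>\<^sub>t \<^bold>\<top>"
      using xy by (auto simp: tle_iff intro: t.le_trans [OF t.meet_le1])
    ultimately show "(x \<^bold>\<and> y) \<^bold>\<and> \<^bold>\<top> = (x \<^bold>\<and> \<^bold>\<top>) \<^bold>\<and> (y \<^bold>\<and> \<^bold>\<top>)"
      "(x \<otimes> y) \<^bold>\<and> \<^bold>\<top> = (x \<^bold>\<and> \<^bold>\<top>) \<^bold>\<and> (y \<^bold>\<and> \<^bold>\<top>)"
      "(x \<^bold>\<or> y) \<^bold>\<and> \<^bold>\<top> = (x \<^bold>\<and> \<^bold>\<top>) \<^bold>\<or> (y \<^bold>\<and> \<^bold>\<top>)"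
      "(x \<oplus> y) \<^bold>\<and> \<^bold>\<top> = (x \<^bold>\<and> \<^bold>\<top>) \<^bold>\<or> (y \<^bold>\<and> \<^bold>\<top>)"
      "(x \<^bold>\<supset> y) \<^bold>\<and> \<^bold>\<top> = ((x \<^bold>\<and> \<^bold>\<top>) \<^bold>\<supset> (x \<^bold>\<and> \<^bold>\<top>) \<^bold>\<and> (y \<^bold>\<and> \<^bold>\<top>)) \<^bold>\<and> \<^bold>\<top>"
      "\<^bold>\<not> (x \<^bold>\<supset> y) \<^bold>\<and> \<^bold>\<top> = (x \<^bold>\<and> \<^bold>\<top>) \<^bold>\<and> (\<^bold>\<not> y \<^bold>\<and> \<^bold>\<top>)"
      using xy mp n by (auto intro!: lower_eqI simp: tmeet_ktop_lower kmeet_ent_iff)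
  qed
  show ?thesis
  proof (rule imp_bilat_homI)
    fix a b assume "a \<in> carrier B" "b \<in> carrier B"
    then show "family_f B (a \<^bold>\<supset> b) =
        family_f B a \<^bold>\<supset>\<^bsub>product_bilat (lower_cilat B)\<^esub> family_f B b"
      using p(5,6) [of a b] by (simp add: family_f_def)
  qed (auto simp: family_f_def p(1-4) tmeet_ktop_lower neg_tmeet neg_tjoin neg_kmeet neg_kjoin)
qed

lemma bij_betw_family_f:
  "bij_betw (family_f B) (carrier B) (carrier (product_bilat (lower_cilat B)))"
  unfolding bij_betw_def
proof
  show "inj_on (family_f B) (carrier B)"
  proof (rule inj_onI)
    fix x y assume *: "x \<in> carrier B" "y \<in> carrier B" "family_f B x = family_f B y"
    then have "ent (x \<^bold>\<and> \<^bold>\<top>) (y \<^bold>\<and> \<^bold>\<top>)" "ent (y \<^bold>\<and> \<^bold>\<top>) (x \<^bold>\<and> \<^bold>\<top>)"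
      "ent (\<^bold>\<not> x \<^bold>\<and> \<^bold>\<top>) (\<^bold>\<not> y \<^bold>\<and> \<^bold>\<top>)" "ent (\<^bold>\<not> y \<^bold>\<and> \<^bold>\<top>) (\<^bold>\<not> x \<^bold>\<and> \<^bold>\<top>)"
      by (simp_all add: family_f_def)
    \<comment> \<open>Meets with \<open>\<top>\<close> drop out, so equal images give the four
      entailments that \<open>tle_iff_ent\<close> needs for both inequalities.\<close>
    then show "x = y"
      using * by (intro t.le_antisym) (simp_all add: tle_iff_ent)
  qed
next
  have "\<langle>a, b\<rangle> = family_f B (a \<otimes> \<^bold>\<not> b)"
    if ab: "a \<in> carrier B" "b \<in> carrier B" "a \<le>\<^sub>t \<^bold>\<top>" "b \<le>\<^sub>t \<^bold>\<top>" for a b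
  proof -
    \<comment> \<open>Designated factors disappear up to equivalence, so
      \<open>a \<otimes> \<not> b\<close> is equivalent to \<open>a\<close>, and its negation
      \<open>\<not> a \<otimes> b\<close> to \<open>b\<close>.\<close>
    have "des (\<^bold>\<not> a)" "des (\<^bold>\<not> b)"
      using ab des_ent [OF des_ktop(1)] by (simp_all add: tle_ktop_iff)
    then have "(a \<otimes> \<^bold>\<not> b) \<^bold>\<and> \<^bold>\<top> = a" "\<^bold>\<not> (a \<otimes> \<^bold>\<not> b) \<^bold>\<and> \<^bold>\<top> = b"
      using ab by (auto intro!: lower_eqI simp: tmeet_ktop_lower neg_kmeet ent_des kmeet_ent_iff)
    then show ?thesis
      using ab by (simp add: family_f_def)
  qed
  then show "family_f B ` carrier B = carrier (product_bilat (lower_cilat B))"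
    using imp_bilat_hom_closed [OF family_f_hom] by (auto simp: image_iff Bex_def)
qed

end

text \<open>Naturality holds because both components of \<open>family_f\<close> are terms, including
  \<open>\<top>\<close>, and homomorphisms commute with terms.\<close>

lemma natural_isomorphism_f:
  "natural_isomorphism ImpBiLat ImpBiLat id_functor (functor_F \<circ>\<^sub>F functor_G)
    (family_f :: 'a univ imp_bilat \<Rightarrow> 'a univ \<Rightarrow> 'a univ)"
  unfolding natural_isomorphism_def natural_transformation_def
proof (intro conjI ballI)
  show "is_functor ImpBiLat ImpBiLat (functor_F \<circ>\<^sub>F (functor_G ::
      ('a univ imp_bilat, 'a univ \<Rightarrow> 'a univ, 'a univ cilat, 'a univ \<Rightarrow> 'a univ) fctr))"
    by (rule is_functor_comp is_functor_F is_functor_G)+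
next
  show "is_functor ImpBiLat ImpBiLat (id_functor ::
      ('a univ imp_bilat, 'a univ \<Rightarrow> 'a univ, 'a univ imp_bilat, 'a univ \<Rightarrow> 'a univ) fctr)"
    by (rule is_functor_id is_category_ImpBiLat)+
next
  fix A B :: "'a univ imp_bilat" and h
  assume "A \<in> Obj ImpBiLat" "B \<in> Obj ImpBiLat" "h \<in> Hom ImpBiLat A B"
  then have A: "implicative_bilattice A" and B: "implicative_bilattice B"
    and h: "h \<in> imp_bilat_hom A B"
    by simp_all
  interpret A: implicative_bilattice A by fact
  have "family_f B (h x) = \<langle>h (ufst (family_f A x)), h (usnd (family_f A x))\<rangle>"
    if "x \<in> carrier A" for x
    using that imp_bilat_hom_ktop [OF A B h] imp_bilat_hom_closed [OF h]
    by (simp add: family_f_def imp_bilat_hom_simps [OF h] imp_bilat_hom_neg [OF h])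
  then show "Cmp ImpBiLat (obj_map id_functor A) (obj_map id_functor B)
      (obj_map (functor_F \<circ>\<^sub>F functor_G) B) (family_f B) (arr_map id_functor A B h) =
    Cmp ImpBiLat (obj_map id_functor A) (obj_map (functor_F \<circ>\<^sub>F functor_G) A)
      (obj_map (functor_F \<circ>\<^sub>F functor_G) B) (arr_map (functor_F \<circ>\<^sub>F functor_G) A B h) (family_f A)"
    using A by (auto simp: id_functor_def comp_functor_def functor_F_def functor_G_def compose_def
        family_f_def tmeet_ktop_lower intro!: restrict_ext)
qed (auto simp: id_functor_def comp_functor_def functor_F_def
    functor_G_def family_f_hom bij_betw_family_f intro: is_isomorphism_ImpBiLat)

section \<open>The isomorphism g from a lattice to the lower part of its product\<close>

context
  fixes L :: "'a univ cilat" (structure)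
  assumes L: "classical_implicative_lattice L"
begin

interpretation classical_implicative_lattice L by (fact L)

interpretation P: implicative_bilattice "product_bilat L"
  by (rule implicative_bilattice_product) (fact L)

text \<open>The pair of units is designated and fixed by the swap, which characterises
  \<open>\<top>\<close>.\<close>

lemma ktop_product: "\<^bold>\<top>\<^bsub>product_bilat L\<^esub> = \<langle>\<one>, \<one>\<rangle>"
  by (rule P.ktop_eqI) (simp_all add: P.des_def closed relc_self)

text \<open>The truth meet with \<open>\<top>\<close> keeps the first component and turns the second
  into \<open>\<one>\<close>.\<close>

lemma carrier_lower_product:
  "carrier (lower_cilat (product_bilat L)) = {\<langle>a, \<one>\<rangle> | a. a \<in> carrier L}"
  by (auto simp: tle_def ktop_product closed)

text \<open>For the relative complement, the final meet with \<open>\<top>\<close> resets the second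
  component to \<open>\<one>\<close>, and \<open>relc_meet_self\<close> removes the extra meet in
  the first.\<close>

lemma family_g_hom: "family_g L \<in> cilat_hom L (lower_cilat (product_bilat L))"
  by (rule cilat_homI)
    (auto simp: family_g_def carrier_lower_product ktop_product closed relc_closed relc_meet_self
      simp del: lower_cilat_simps(1))

lemma bij_betw_family_g: "bij_betw (family_g L) (carrier L) (carrier (lower_cilat (product_bilat L)))"
  unfolding carrier_lower_product by (auto simp: bij_betw_def inj_on_def family_g_def)

end

text \<open>Both sides of the naturality square send \<open>a\<close> to
  \<open>\<langle>h a, \<one>\<rangle>\<close>, because \<open>h\<close> preserves the unit.\<close>

lemma natural_isomorphism_g:
  "natural_isomorphism CILat CILat id_functor (functor_G \<circ>\<^sub>F functor_F)
    (family_g :: 'a univ cilat \<Rightarrow> 'a univ \<Rightarrow> 'a univ)"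
  unfolding natural_isomorphism_def natural_transformation_def
proof (intro conjI ballI)
  show "is_functor CILat CILat ((functor_G :: ('a univ imp_bilat, 'a univ \<Rightarrow> 'a univ,
      'a univ cilat, 'a univ \<Rightarrow> 'a univ) fctr) \<circ>\<^sub>F functor_F)"
    by (rule is_functor_comp is_functor_F is_functor_G)+
next
  show "is_functor CILat CILat (id_functor ::
      ('a univ cilat, 'a univ \<Rightarrow> 'a univ, 'a univ cilat, 'a univ \<Rightarrow> 'a univ) fctr)"
    by (rule is_functor_id is_category_CILat)+
next
  fix L M :: "'a univ cilat" and h
  assume "L \<in> Obj CILat" "M \<in> Obj CILat" "h \<in> Hom CILat L M"
  then have L: "classical_implicative_lattice L" and h: "h \<in> cilat_hom L M"
    by simp_all
  interpret L: classical_implicative_lattice L by fact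
  show "Cmp CILat (obj_map id_functor L) (obj_map id_functor M)
      (obj_map (functor_G \<circ>\<^sub>F functor_F) M) (family_g M) (arr_map id_functor L M h) =
    Cmp CILat (obj_map id_functor L) (obj_map (functor_G \<circ>\<^sub>F functor_F) L)
      (obj_map (functor_G \<circ>\<^sub>F functor_F) M) (arr_map (functor_G \<circ>\<^sub>F functor_F) L M h) (family_g L)"
    using cilat_hom_closed [OF h] cilat_hom_one [OF h]
    by (auto simp: id_functor_def comp_functor_def functor_F_def functor_G_def compose_def
        family_g_def carrier_lower_product [OF L] L.one_closed simp del: lower_cilat_simps(1)
        intro!: restrict_ext)
qed (auto simp: id_functor_def comp_functor_def functor_F_def
    functor_G_def family_g_hom bij_betw_family_g simp del: lower_cilat_simps(1)
    intro: is_isomorphism_CILat)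

theorem theorem5p6p9:
  shows "is_functor CILat ImpBiLat
           (functor_F :: ('a univ cilat, 'a univ \<Rightarrow> 'a univ, 'a univ imp_bilat, 'a univ \<Rightarrow> 'a univ) fctr) \<and>
         is_functor ImpBiLat CILat
           (functor_G :: ('a univ imp_bilat, 'a univ \<Rightarrow> 'a univ, 'a univ cilat, 'a univ \<Rightarrow> 'a univ) fctr) \<and>
         natural_isomorphism ImpBiLat ImpBiLat id_functor (functor_F \<circ>\<^sub>F functor_G)
           (family_f :: 'a univ imp_bilat \<Rightarrow> 'a univ \<Rightarrow> 'a univ) \<and>
         natural_isomorphism CILat CILat id_functor (functor_G \<circ>\<^sub>F functor_F)
           (family_g :: 'a univ cilat \<Rightarrow> 'a univ \<Rightarrow> 'a univ) \<and>
         naturally_equivalent (CILat :: ('a univ cilat, 'a univ \<Rightarrow> 'a univ) cat)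
           (ImpBiLat :: ('a univ imp_bilat, 'a univ \<Rightarrow> 'a univ) cat)"
  \<comment> \<open>The witnesses for \<open>S\<close>, \<open>T\<close>, \<open>\<eta>\<close>,
    \<open>\<theta>\<close> are \<open>functor_F\<close>, \<open>functor_G\<close>,
    \<open>family_f\<close>, \<open>family_g\<close>.\<close>
  unfolding naturally_equivalent_def
  using is_functor_F is_functor_G natural_isomorphism_f natural_isomorphism_g by blast

end
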